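(* There is a function $\Omega\to\mathbb{R}$, $\overline{\alpha}\mapsto \mathbf{t}_{\overline{\alpha}}$ (depending only on the type $\overline{\alpha}$, not on any polytope), such that every compact Coxeter polytope $P\subset\mathbb{H}^3$ has an edge $E$ whose associated ridge $\Sigma_E$, of type $\overline{\alpha}$, has width less than $\mathbf{t}_{\overline{\alpha}}$. Moreover, $$\max_{\overline{\alpha}\in\Omega}\mathbf{t}_{\overline{\alpha}}=\mathbf{t}_{(\pi/5,\pi/3,\pi/3,\pi/2,\pi/2)}<5.75 .$$
   Context: $\mathbb{H}^3$ is hyperbolic 3-space with metric $\rho$. A Coxeter polytope is a convex polytope (intersection of finitely many half-spaces with nonempty interior) all of whose dihedral angles are of the form $\pi/k$ with $k\ge 2$ an integer; compact ones are simple. A facet is a face of codimension 1. For an edge $E$ of a compact Coxeter polytope $P\subset\mathbb{H}^3$ with vertices $V_1,V_2$, let $F_1,F_2$ be the two facets containing $E$, and let the framing facets of $E$ be $F_3$ (the facet containing $V_1$ but not $E$) and $F_4$ (the facet containing $V_2$ but not $E$). The ridge associated with $E$ is $\Sigma_E=\{F_1,F_2,F_3,F_4\}$; its width is $\cosh\rho(F_3,F_4)$, where $\rho(F_3,F_4)$ is the distance between the facets (equal to $0$ if they meet). Its type is the tuple $\overline{\alpha}=(\alpha_{12},\alpha_{13},\alpha_{14},\alpha_{23},\alpha_{24})$, where $\alpha_{ij}$ is the dihedral angle between $F_i$ and $F_j$. $\Omega$ denotes the set of all types of ridges that occur in compact Coxeter polytopes in $\mathbb{H}^3$. *)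

theory Defs
  imports "HOL-Analysis.Analysis"
begin

text \<open>Hyperboloid model of hyperbolic 3-space inside real^4 with the Lorentzian form
  of signature (-,+,+,+).\<close>

definition lor :: "real^4 \<Rightarrow> real^4 \<Rightarrow> real" where
  "lor x y = - (x$1 * y$1) + x$2 * y$2 + x$3 * y$3 + x$4 * y$4"

definition H3 :: "(real^4) set" where
  "H3 = {x. lor x x = -1 \<and> x$1 > 0}"

definition hdist :: "real^4 \<Rightarrow> real^4 \<Rightarrow> real" where
  "hdist x y = arcosh (- lor x y)"

text \<open>Hyperbolic plane with unit spacelike normal e, and the closed half-space
  it bounds (e is the outward normal).\<close>
definition hplane :: "real^4 \<Rightarrow> (real^4) set" where
  "hplane e = {x \<in> H3. lor x e = 0}"

definition halfsp :: "real^4 \<Rightarrow> (real^4) set" where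
  "halfsp e = {x \<in> H3. lor x e \<le> 0}"

definition convex_polytope :: "(real^4) set \<Rightarrow> bool" where
  "convex_polytope P \<longleftrightarrow>
     (\<exists>N. finite N \<and> (\<forall>e\<in>N. lor e e = 1) \<and> P = H3 \<inter> (\<Inter>e\<in>N. halfsp e)) \<and>
     (\<exists>U. openin (top_of_set H3) U \<and> U \<noteq> {} \<and> U \<subseteq> P)"

definition facet_normal :: "(real^4) set \<Rightarrow> real^4 \<Rightarrow> bool" where
  "facet_normal P e \<longleftrightarrow> lor e e = 1 \<and> P \<subseteq> halfsp e \<and>
     (\<exists>U. openin (top_of_set (hplane e)) U \<and> U \<noteq> {} \<and> U \<subseteq> P)"

definition hfacet :: "(real^4) set \<Rightarrow> real^4 \<Rightarrow> (real^4) set" where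
  "hfacet P e = P \<inter> hplane e"

text \<open>Two facets are adjacent if they are distinct and meet along an edge
  (their intersection has more than one point).\<close>
definition adjacent :: "(real^4) set \<Rightarrow> real^4 \<Rightarrow> real^4 \<Rightarrow> bool" where
  "adjacent P e1 e2 \<longleftrightarrow> facet_normal P e1 \<and> facet_normal P e2 \<and>
     hfacet P e1 \<noteq> hfacet P e2 \<and>
     (\<exists>x y. x \<noteq> y \<and> x \<in> hfacet P e1 \<inter> hfacet P e2 \<and> y \<in> hfacet P e1 \<inter> hfacet P e2)"

definition dihedral :: "real^4 \<Rightarrow> real^4 \<Rightarrow> real" where
  "dihedral e1 e2 = arccos (- lor e1 e2)"

definition coxeter_polytope :: "(real^4) set \<Rightarrow> bool" where
  "coxeter_polytope P \<longleftrightarrow> convex_polytope P \<and>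
     (\<forall>e1 e2. adjacent P e1 e2 \<longrightarrow> (\<exists>k::nat. k \<ge> 2 \<and> dihedral e1 e2 = pi / real k))"

definition compact_coxeter_polytope :: "(real^4) set \<Rightarrow> bool" where
  "compact_coxeter_polytope P \<longleftrightarrow> coxeter_polytope P \<and> compact P"

text \<open>Ridge: F1 = facet e1, F2 = facet e2 contain the edge E = F1 \<inter> F2;
  F3, F4 are the framing facets, each meeting E (at a vertex) without containing E,
  at two different vertices.\<close>
definition is_ridge :: "(real^4) set \<Rightarrow> real^4 \<Rightarrow> real^4 \<Rightarrow> real^4 \<Rightarrow> real^4 \<Rightarrow> bool" where
  "is_ridge P e1 e2 e3 e4 \<longleftrightarrow>
     adjacent P e1 e2 \<and> facet_normal P e3 \<and> facet_normal P e4 \<and>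
     (let E = hfacet P e1 \<inter> hfacet P e2 in
        hfacet P e3 \<inter> E \<noteq> {} \<and> \<not> E \<subseteq> hfacet P e3 \<and>
        hfacet P e4 \<inter> E \<noteq> {} \<and> \<not> E \<subseteq> hfacet P e4 \<and>
        hfacet P e3 \<inter> E \<noteq> hfacet P e4 \<inter> E)"

definition ridge_width :: "(real^4) set \<Rightarrow> real^4 \<Rightarrow> real^4 \<Rightarrow> real" where
  "ridge_width P e3 e4 =
     cosh (Inf {hdist x y | x y. x \<in> hfacet P e3 \<and> y \<in> hfacet P e4})"

type_synonym ridge_type = "real \<times> real \<times> real \<times> real \<times> real"

definition ridge_type_of :: "real^4 \<Rightarrow> real^4 \<Rightarrow> real^4 \<Rightarrow> real^4 \<Rightarrow> ridge_type" where
  "ridge_type_of e1 e2 e3 e4 =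
     (dihedral e1 e2, dihedral e1 e3, dihedral e1 e4, dihedral e2 e3, dihedral e2 e4)"

definition Omega :: "ridge_type set" where
  "Omega = {ridge_type_of e1 e2 e3 e4 | P e1 e2 e3 e4.
              compact_coxeter_polytope P \<and> is_ridge P e1 e2 e3 e4}"

end

theory Submission
  imports Defs
begin

text \<open>
  Every compact Coxeter polytope has an edge of width at most 5.62, so a constant \<open>t = 5.7\<close> works.

  Pass to the cone over the polytope in Minkowski space, cut out by the outward facet normals.
  Farkas' lemma on a facet cone, which is cut out by adjacent facets only, shows that all distinct
  normals satisfy \<open>lor e f \<le> 0\<close> (Andreev's theorem). Hence vertices are simple, and the common
  perpendicular of two ultraparallel facet planes ends in the facets, so that a ridge has width
  at most \<open>max 1 (- lor e3 e4)\<close>.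

  Fix an interior point p and choose the edge \<open>F1 \<inter> F2\<close> farthest from p (Nikulin's method). At each
  end V of it, compare with the other edges at V of F1 and F2: the distance x from V to the foot of the
  perpendicular from p satisfies \<open>sinh x \<le> cot (\<theta> / 2)\<close>, where \<open>\<theta>\<close> is the angle of F1 (or of F2) at V. Taking
  the better of the two faces at each end bounds \<open>- lor e3 e4\<close> by 5.62 for all Coxeter angles.

  The type \<open>(pi/5, pi/3, pi/3, pi/2, pi/2)\<close> occurs in the compact simplex with diagram \<open>[5,3\<^sup>1\<^sup>,\<^sup>1]\<close>.
\<close>

section \<open>Minkowski space\<close>

lemma lor_commute: "lor x y = lor y x"
  by (simp add: lor_def algebra_simps)

lemma lor_simps [simp]:
  "lor (x + y) z = lor x z + lor y z" "lor z (x + y) = lor z x + lor z y"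
  "lor (x - y) z = lor x z - lor y z" "lor z (x - y) = lor z x - lor z y"
  "lor (c *\<^sub>R x) z = c * lor x z" "lor z (c *\<^sub>R x) = c * lor z x"
  "lor (- x) z = - lor x z" "lor z (- x) = - lor z x"
  "lor 0 z = 0" "lor z 0 = 0"
  by (simp_all add: lor_def algebra_simps)

lemma lor_sum_left: "lor (\<Sum>i\<in>A. f i) z = (\<Sum>i\<in>A. lor (f i) z)"
  by (induction A rule: infinite_finite_induct) auto

lemma lor_sum_right: "lor z (\<Sum>i\<in>A. f i) = (\<Sum>i\<in>A. lor z (f i))"
  by (induction A rule: infinite_finite_induct) auto

text \<open>Reversing time turns \<open>lor\<close> into the Euclidean inner product, so that
  Euclidean facts on dimension and separation carry over.\<close>

definition tflip :: "real^4 \<Rightarrow> real^4" where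
  "tflip x = (\<chi> i. if i = 1 then - x$i else x$i)"

lemma tflip_tflip [simp]: "tflip (tflip x) = x"
  by (simp add: tflip_def vec_eq_iff)

lemma linear_tflip: "linear tflip"
  by (auto intro!: linearI simp: tflip_def vec_eq_iff)

lemma tflip_minus [simp]: "tflip (- x) = - tflip x"
  by (simp add: tflip_def vec_eq_iff)

lemma lor_eq_inner: "lor x y = inner (tflip x) y"
  by (simp add: lor_def inner_vec_def sum_4 tflip_def)

lemma continuous_on_lor [continuous_intros]:
  "continuous_on S f \<Longrightarrow> continuous_on S g \<Longrightarrow> continuous_on S (\<lambda>x. lor (f x) (g x))"
  unfolding lor_def by (intro continuous_intros)

lemma vec4_eq_0_iff: "(x::real^4) = 0 \<longleftrightarrow> x$1 = 0 \<and> x$2 = 0 \<and> x$3 = 0 \<and> x$4 = 0"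
  by (simp add: vec_eq_iff forall_4)

definition spat :: "real^4 \<Rightarrow> real^4 \<Rightarrow> real" where
  "spat x y = x$2 * y$2 + x$3 * y$3 + x$4 * y$4"

lemma lor_spat: "lor x y = spat x y - x$1 * y$1"
  by (simp add: lor_def spat_def)

lemma spat_nonneg: "spat x x \<ge> 0"
  by (simp add: spat_def)

lemma spat_Cauchy_Schwarz: "(spat x y)\<^sup>2 \<le> spat x x * spat y y"
proof -
  have "spat x x * spat y y - (spat x y)\<^sup>2 =
    (x$2 * y$3 - x$3 * y$2)\<^sup>2 + (x$2 * y$4 - x$4 * y$2)\<^sup>2 + (x$3 * y$4 - x$4 * y$3)\<^sup>2"
    by (simp add: spat_def power2_eq_square algebra_simps)
  thus ?thesis by (smt (verit) zero_le_power2)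
qed

lemma spat_self_eq_0_iff: "spat x x = 0 \<longleftrightarrow> x$2 = 0 \<and> x$3 = 0 \<and> x$4 = 0"
  unfolding spat_def by (smt (verit) mult_eq_0_iff zero_le_square)

text \<open>The form has a single negative direction, so it is positive definite on the complement
  of a timelike vector. The spatial Cauchy-Schwarz inequality is combined with the equality of
  spatial and time products given by \<open>yq\<close>.\<close>

lemma lor_orthogonal_timelike:
  assumes q: "lor q q < 0" and yq: "lor y q = 0" and "y \<noteq> 0"
  shows "lor y y > 0"
proof (cases "spat y y = 0")
  case True
  hence y: "y$2 = 0" "y$3 = 0" "y$4 = 0" by (auto simp: spat_self_eq_0_iff)
  have "q$1 \<noteq> 0" using q spat_nonneg[of q] by (auto simp: lor_spat)
  hence "y$1 = 0" using yq y by (simp add: lor_def)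
  thus ?thesis using y \<open>y \<noteq> 0\<close> vec4_eq_0_iff by blast
next
  case False
  hence sp: "spat y y > 0" using spat_nonneg[of y] by linarith
  have "(y$1 * q$1)\<^sup>2 = (spat y q)\<^sup>2" using yq by (simp add: lor_spat)
  also have "\<dots> \<le> spat y y * spat q q" by (rule spat_Cauchy_Schwarz)
  also have "\<dots> < spat y y * (q$1 * q$1)"
    using q sp by (intro mult_strict_left_mono) (auto simp: lor_spat)
  finally have "(y$1 * y$1) * (q$1 * q$1) < spat y y * (q$1 * q$1)"
    by (simp add: power2_eq_square algebra_simps)
  hence "y$1 * y$1 < spat y y" by (smt (verit) mult_right_mono zero_le_square)
  thus ?thesis by (simp add: lor_spat)
qed

text \<open>The component \<open>z\<close> of \<open>y\<close> orthogonal to \<open>q\<close> has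
  nonnegative square, and multiplying by \<open>lor q q < 0\<close> reverses the usual
  inequality.\<close>

lemma lor_reversed_Cauchy_Schwarz:
  assumes q: "lor q q < 0"
  shows "lor y y * lor q q \<le> (lor y q)\<^sup>2"
proof -
  define z where "z = y - (lor y q / lor q q) *\<^sub>R q"
  have "lor z q = 0" using q by (simp add: z_def)
  hence "lor z z \<ge> 0" using lor_orthogonal_timelike[OF q] by (cases "z = 0") force+
  moreover have "lor z z * lor q q = lor y y * lor q q - (lor y q)\<^sup>2"
    using q by (simp add: z_def lor_commute[of q y] field_simps power2_eq_square)
  ultimately show ?thesis using q
    by (smt (verit) mult_nonneg_nonpos)
qed

text \<open>The open cone over \<open>H3\<close>; \<open>nz\<close> below projects it radially back
  to \<open>H3\<close>.\<close>

definition Fut :: "(real^4) set" where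
  "Fut = {x. lor x x < 0 \<and> x$1 > 0}"

lemma FutD: "x \<in> Fut \<Longrightarrow> lor x x < 0" "x \<in> Fut \<Longrightarrow> x$1 > 0" "x \<in> Fut \<Longrightarrow> x \<noteq> 0"
  by (auto simp: Fut_def)

lemma lor_Fut_neg:
  assumes "x \<in> Fut" "y \<in> Fut" shows "lor x y < 0"
proof -
  have "(spat x y)\<^sup>2 \<le> spat x x * spat y y" by (rule spat_Cauchy_Schwarz)
  also have "\<dots> < (x$1 * x$1) * (y$1 * y$1)"
    using assms spat_nonneg[of x] spat_nonneg[of y]
    by (intro mult_strict_mono') (auto simp: Fut_def lor_spat)
  finally have "(spat x y)\<^sup>2 < (x$1 * y$1)\<^sup>2" by (simp add: power2_eq_square algebra_simps)
  hence "spat x y < x$1 * y$1"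
    using assms by (intro power2_less_imp_less[of _ "x$1 * y$1"]) (auto simp: Fut_def)
  thus ?thesis by (simp add: lor_spat)
qed

lemma H3_Fut: "x \<in> H3 \<Longrightarrow> x \<in> Fut"
  by (auto simp: H3_def Fut_def)

lemma Fut_add: "x \<in> Fut \<Longrightarrow> y \<in> Fut \<Longrightarrow> x + y \<in> Fut"
  using lor_Fut_neg[of x y] by (auto simp: Fut_def lor_commute[of y x])

lemma open_Fut: "open Fut"
proof -
  have *: "Fut = {x. lor x x < 0} \<inter> {x. 0 < x$1}" by (auto simp: Fut_def)
  show ?thesis unfolding * by (intro open_Int open_Collect_less continuous_intros)
qed

lemma H3_lor_le:
  assumes "x \<in> H3" "y \<in> H3" shows "lor x y \<le> -1"
proof (rule ccontr)
  assume "\<not> ?thesis"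
  hence "\<bar>lor x y\<bar> < 1" using lor_Fut_neg[of x y] assms H3_Fut by auto
  hence "(lor x y)\<^sup>2 < 1" by (simp add: abs_square_less_1)
  thus False using lor_reversed_Cauchy_Schwarz[of y x] assms by (simp add: H3_def)
qed

definition nz :: "real^4 \<Rightarrow> real^4" where
  "nz x = (1 / sqrt (- lor x x)) *\<^sub>R x"

lemma lor_nz [simp]: "lor (nz x) y = lor x y / sqrt (- lor x x)"
  "lor y (nz x) = lor y x / sqrt (- lor x x)"
  by (simp_all add: nz_def)

lemma nz_in_H3: "x \<in> Fut \<Longrightarrow> nz x \<in> H3"
  by (auto simp: H3_def Fut_def nz_def field_simps)

lemma nz_id: "x \<in> H3 \<Longrightarrow> nz x = x"
  by (auto simp: H3_def nz_def)

lemma lor_nz_sign: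
  assumes "x \<in> Fut"
  shows "lor (nz x) y \<le> 0 \<longleftrightarrow> lor x y \<le> 0" "lor (nz x) y = 0 \<longleftrightarrow> lor x y = 0"
    "lor (nz x) y < 0 \<longleftrightarrow> lor x y < 0"
  using FutD[OF assms] by (auto simp: field_simps)

section \<open>Orthogonality, duality and perturbation\<close>

lemma exists_lor_orthogonal:
  obtains v where "v \<noteq> 0" "lor v a = 0" "lor v b = 0" "lor v c = 0"
proof -
  have "dim {tflip a, tflip b, tflip c} \<le> card {tflip a, tflip b, tflip c}"
    by (rule dim_le_card) (auto intro: span_base)
  also have "\<dots> \<le> 3" by (simp add: card_insert_if)
  finally have "dim {tflip a, tflip b, tflip c} < DIM(real^4)" by simp
  then obtain v where "v \<noteq> 0" "\<And>y. y \<in> span {tflip a, tflip b, tflip c} \<Longrightarrow> orthogonal v y"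
    using orthogonal_to_subspace_exists by blast
  moreover from this have "lor v x = 0" if "x \<in> {a,b,c}" for x
  proof -
    have "tflip x \<in> span {tflip a, tflip b, tflip c}" using that by (auto intro: span_base)
    from \<open>\<And>y. y \<in> span _ \<Longrightarrow> orthogonal v y\<close>[OF this] show ?thesis
      unfolding orthogonal_def lor_commute[of v x] lor_eq_inner[of x v] by (metis inner_commute)
  qed
  ultimately show ?thesis using that by blast
qed

text \<open>After time reversal of \<open>B\<close> this is the dimension count for a Euclidean
  orthogonal complement. It limits how many walls can pass through an edge or a vertex.\<close>

lemma card_orthogonal_independent_le:
  assumes A: "independent A" and B: "independent B" and orth: "\<And>a b. a \<in> A \<Longrightarrow> b \<in> B \<Longrightarrow> lor a b = 0"
  shows "card A + card B \<le> 4"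
proof -
  have inj: "inj tflip" by (metis injI tflip_tflip)
  have "dim {y \<in> UNIV. \<forall>x\<in>span (tflip ` B). orthogonal x y} + dim (span (tflip ` B)) = dim (UNIV::(real^4) set)"
    by (rule dim_subspace_orthogonal_to_vectors) auto
  moreover have "dim (span (tflip ` B)) = card B"
    using linear_independent_injective_image[OF linear_tflip B inj_on_subset[OF inj subset_UNIV]] inj
    by (metis card_image dim_eq_card_independent dim_span inj_on_subset subset_UNIV)
  moreover have "A \<subseteq> {y \<in> UNIV. \<forall>x\<in>span (tflip ` B). orthogonal x y}"
  proof
    fix a assume a: "a \<in> A"
    have "tflip b \<in> {x. orthogonal a x}" if "b \<in> B" for b
      using orth[OF a that] unfolding lor_commute[of a b] lor_eq_inner[of b a]
      by (simp add: orthogonal_def inner_commute[of a])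
    hence "span (tflip ` B) \<subseteq> {x. orthogonal a x}"
      by (intro span_minimal subspace_orthogonal_to_vector) auto
    thus "a \<in> {y \<in> UNIV. \<forall>x\<in>span (tflip ` B). orthogonal x y}"
      by (auto simp: orthogonal_commute)
  qed
  hence "card A \<le> dim {y \<in> UNIV. \<forall>x\<in>span (tflip ` B). orthogonal x y}"
    using A independent_card_le_dim by blast
  ultimately show ?thesis by simp
qed

text \<open>The hull of a finite set is closed, so a point outside is strictly separated from it;
  the negated, time-reversed normal of the separating hyperplane violates
  \<open>neg\<close>.\<close>

lemma lor_Farkas:
  fixes S :: "(real^4) set"
  assumes "finite S" and neg: "\<And>z. (\<And>s. s \<in> S \<Longrightarrow> lor z s \<le> 0) \<Longrightarrow> lor z e \<le> 0"
  shows "e \<in> convex_cone hull S"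
proof (rule ccontr)
  let ?C = "convex_cone hull S"
  assume "e \<notin> ?C"
  moreover have "closed ?C" "convex ?C"
    using closed_convex_cone_hull[OF assms(1)] convex_convex_cone_hull by auto
  ultimately obtain a b where a: "inner a e < b" "\<And>x. x \<in> ?C \<Longrightarrow> inner a x > b"
    using separating_hyperplane_closed_point[of ?C e] by auto
  have b: "b < 0" using a(2)[OF convex_cone_hull_contains_0] by simp
  have "lor (- tflip a) s \<le> 0" if "s \<in> S" for s
  proof (rule ccontr)
    assume "\<not> ?thesis"
    hence as: "inner a s < 0" by (simp add: lor_eq_inner)
    have "s \<in> ?C" using that by (simp add: hull_inc)
    \<comment> \<open>This multiple lies on the separating hyperplane itself, while the cone lies
      strictly beyond it.\<close>
    hence "(b / inner a s) *\<^sub>R s \<in> ?C" using as b by (intro convex_cone_hull_mul) (auto simp: divide_nonpos_neg)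
    from a(2)[OF this] as show False by simp
  qed
  from neg[OF this] a(1) b show False by (simp add: lor_eq_inner)
qed

lemma convex_cone_lor_le: "convex_cone {y. lor z y \<le> 0}"
  by (auto simp: convex_cone_iff mult_nonneg_nonpos)

lemma lor_convex_cone_hull_le:
  assumes "y \<in> convex_cone hull S" "\<And>s. s \<in> S \<Longrightarrow> lor z s \<le> 0"
  shows "lor z y \<le> 0"
  using hull_minimal[of S "{y. lor z y \<le> 0}" convex_cone] convex_cone_lor_le assms by blast

text \<open>The origin together with an open half-space is still a convex cone, so strictness passes
  to all nonzero combinations.\<close>

lemma lor_convex_cone_hull_less:
  assumes "y \<in> convex_cone hull S" "\<And>s. s \<in> S \<Longrightarrow> lor z s < 0" "y \<noteq> 0"
  shows "lor z y < 0"
proof -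
  have "convex_cone {y. y = 0 \<or> lor z y < 0}"
    by (auto simp: convex_cone_iff mult_less_0_iff)
  with hull_minimal[of S "{y. y = 0 \<or> lor z y < 0}" convex_cone] assms show ?thesis by blast
qed

lemma lor_perturb_neg:
  assumes "finite A" "\<And>l. l \<in> A \<Longrightarrow> lor w l < 0"
  obtains \<epsilon> :: real where "\<epsilon> > 0" "\<And>l. l \<in> A \<Longrightarrow> lor (w + \<epsilon> *\<^sub>R v) l < 0"
proof -
  have "\<forall>\<^sub>F t in at_right 0. \<forall>l\<in>A. lor (w + t *\<^sub>R v) l < 0"
  proof (rule eventually_ball_finite[OF assms(1)], rule)
    fix l assume "l \<in> A"
    have "((\<lambda>t. lor w l + t * lor v l) \<longlongrightarrow> lor w l + 0 * lor v l) (at_right 0)"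
      by (intro tendsto_intros)
    from order_tendstoD(2)[OF this, of 0] assms(2)[OF \<open>l \<in> A\<close>]
    show "\<forall>\<^sub>F t in at_right 0. lor (w + t *\<^sub>R v) l < 0" by simp
  qed
  then obtain \<epsilon> where "\<epsilon> > 0" "\<forall>l\<in>A. lor (w + \<epsilon> *\<^sub>R v) l < 0"
    by (metis (mono_tags, lifting) eventually_at_right_field dense)
  thus ?thesis using that by blast
qed

lemma openin_perturb:
  assumes U: "openin (top_of_set S) U" "x \<in> U" and x: "x \<in> H3"
    and S: "\<And>t. x + t *\<^sub>R v \<in> Fut \<Longrightarrow> nz (x + t *\<^sub>R v) \<in> S"
  obtains t where "t > 0" "x + t *\<^sub>R v \<in> Fut" "nz (x + t *\<^sub>R v) \<in> U"
proof -
  obtain T where T: "open T" "U = S \<inter> T" using U by (auto simp: openin_open)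
  have l: "((\<lambda>t. x + t *\<^sub>R v) \<longlongrightarrow> x + 0 *\<^sub>R v) (at_right 0)" by (intro tendsto_intros)
  have lx: "lor x x = -1" using x by (simp add: H3_def)
  have "((\<lambda>t. lor (x + t *\<^sub>R v) (x + t *\<^sub>R v)) \<longlongrightarrow> lor x x) (at_right 0)"
    unfolding lor_simps by (auto intro!: tendsto_eq_intros)
  hence l2: "((\<lambda>t. nz (x + t *\<^sub>R v)) \<longlongrightarrow> nz x) (at_right 0)"
    unfolding nz_def using l lx by (auto intro!: tendsto_eq_intros)
  have "\<forall>\<^sub>F t in at_right 0. x + t *\<^sub>R v \<in> Fut"
    using topological_tendstoD[OF l open_Fut] H3_Fut[OF x] by simp
  moreover have "\<forall>\<^sub>F t in at_right 0. nz (x + t *\<^sub>R v) \<in> T"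
    using topological_tendstoD[OF l2 T(1)] U(2) T(2) nz_id[OF x] by simp
  moreover have "\<forall>\<^sub>F t in at_right (0::real). t > 0" by (simp add: eventually_at_right_less)
  ultimately have "\<forall>\<^sub>F t in at_right 0. t > 0 \<and> x + t *\<^sub>R v \<in> Fut \<and> nz (x + t *\<^sub>R v) \<in> T"
    by eventually_elim auto
  then obtain t where "t > 0" "x + t *\<^sub>R v \<in> Fut" "nz (x + t *\<^sub>R v) \<in> T"
    using eventually_happens trivial_limit_at_right_real by blast
  thus ?thesis using that S T(2) by blast
qed

section \<open>Polyhedral cones\<close>

definition pcone :: "(real^4) set \<Rightarrow> (real^4) set" where
  "pcone N = {z. \<forall>e\<in>N. lor z e \<le> 0}"

lemma pconeD: "z \<in> pcone N \<Longrightarrow> e \<in> N \<Longrightarrow> lor z e \<le> 0"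
  by (simp add: pcone_def)

lemma pcone_add: "x \<in> pcone N \<Longrightarrow> y \<in> pcone N \<Longrightarrow> x + y \<in> pcone N"
  by (auto simp: pcone_def intro: add_nonpos_nonpos)

lemma pcone_scale: "x \<in> pcone N \<Longrightarrow> c \<ge> 0 \<Longrightarrow> c *\<^sub>R x \<in> pcone N"
  by (auto simp: pcone_def mult_nonneg_nonpos)

lemma nz_pcone: "x \<in> pcone N \<Longrightarrow> x \<in> Fut \<Longrightarrow> nz x \<in> pcone N"
  unfolding pcone_def using lor_nz_sign(1) by blast

text \<open>Along the segment from \<open>p\<close> to \<open>z\<close>, membership in
  \<open>Fut\<close> is an open condition, and boundedness of the slice makes it a closed one as
  well, so connectedness carries it from \<open>p\<close> to \<open>z\<close>.\<close>

lemma bounded_pcone_Fut: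
  assumes "N \<noteq> {}" and p: "p \<in> H3" "\<And>e. e \<in> N \<Longrightarrow> lor p e < 0"
    and bd: "bounded (H3 \<inter> pcone N)" and z: "z \<in> pcone N" "z \<noteq> 0"
  shows "z \<in> Fut"
proof -
  obtain M where M: "\<And>x. x \<in> H3 \<inter> pcone N \<Longrightarrow> norm x \<le> M"
    using bd by (auto simp: bounded_iff)
  define S where "S = closed_segment p z"
  have S: "y \<in> pcone N" "y \<noteq> 0" if yS: "y \<in> S" for y
  proof -
    obtain t where t: "0 \<le> t" "t \<le> 1" "y = (1 - t) *\<^sub>R p + t *\<^sub>R z"
      using yS by (auto simp: S_def in_segment)
    have pp: "p \<in> pcone N" using p(2) by (auto simp: pcone_def less_imp_le)
    show "y \<in> pcone N" unfolding t(3) using t pp z by (intro pcone_add pcone_scale) auto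
    show "y \<noteq> 0"
    proof (cases "t = 1")
      case True thus ?thesis using t z by simp
    next
      case False
      obtain e where e: "e \<in> N" using assms(1) by blast
      have "(1 - t) * lor p e < 0" using False t p(2)[OF e] by (simp add: mult_pos_neg)
      moreover have "t * lor z e \<le> 0" using t pconeD[OF z(1) e] by (simp add: mult_nonneg_nonpos)
      ultimately have "lor y e < 0" by (simp add: t(3))
      thus ?thesis by auto
    qed
  qed
  \<comment> \<open>The bound \<open>M\<close> on the time coordinate of \<open>nz y\<close> turns
    the strict conditions defining \<open>Fut\<close> into non-strict ones.\<close>
  have iff: "y \<in> Fut \<longleftrightarrow> 0 \<le> y$1 \<and> (y$1)\<^sup>2 \<le> M\<^sup>2 * (- lor y y)" if "y \<in> S" for y
  proof
    assume y: "y \<in> Fut"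
    have "nz y \<in> H3 \<inter> pcone N" using y nz_in_H3 nz_pcone S(1)[OF that] by blast
    hence "norm (nz y) \<le> M" by (rule M)
    moreover have "\<bar>nz y $ 1\<bar> \<le> norm (nz y)" by (rule component_le_norm_cart)
    ultimately have "\<bar>nz y $ 1\<bar> \<le> M" by linarith
    hence "(nz y $ 1)\<^sup>2 \<le> M\<^sup>2" by (metis abs_ge_zero power2_abs power_mono)
    thus "0 \<le> y$1 \<and> (y$1)\<^sup>2 \<le> M\<^sup>2 * (- lor y y)"
      using FutD(1,2)[OF y] by (simp add: nz_def power_divide minus_divide_right pos_divide_le_eq
          del: divide_minus_right)
  next
    assume y: "0 \<le> y$1 \<and> (y$1)\<^sup>2 \<le> M\<^sup>2 * (- lor y y)"
    \<comment> \<open>Otherwise the time coordinate vanishes, \<open>y\<close> is spacelike and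
      \<open>M\<close> is 0, which would force \<open>p\<close> to be 0.\<close>
    have "lor y y < 0"
    proof (rule ccontr)
      assume *: "\<not> lor y y < 0"
      hence "M\<^sup>2 * (- lor y y) \<le> 0" by (simp add: mult_nonneg_nonpos)
      hence y0: "y$1 = 0" using y by (smt (verit) zero_eq_power2 zero_le_power2)
      hence "spat y y > 0"
        using S(2)[OF that] spat_nonneg[of y] spat_self_eq_0_iff[of y] vec4_eq_0_iff[of y] by fastforce
      hence "lor y y > 0" using y0 by (simp add: lor_spat)
      moreover have "M\<^sup>2 * (- lor y y) \<ge> 0" using y by (smt (verit) zero_le_power2)
      ultimately have "M = 0" by (smt (verit) mult_pos_neg zero_le_power2 zero_eq_power2)
      moreover have "p \<in> H3 \<inter> pcone N" using p by (auto simp: pcone_def less_imp_le)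
      ultimately have "p = 0" using M by fastforce
      thus False using p(1) by (simp add: H3_def)
    qed
    moreover from this have "y$1 \<noteq> 0" using spat_nonneg[of y] by (auto simp: lor_spat)
    ultimately show "y \<in> Fut" using y by (auto simp: Fut_def)
  qed
  have eq: "S \<inter> Fut = S \<inter> {y. 0 \<le> y$1 \<and> (y$1)\<^sup>2 \<le> M\<^sup>2 * (- lor y y)}" using iff by blast
  have "closed {y. 0 \<le> y$1 \<and> (y$1)\<^sup>2 \<le> M\<^sup>2 * (- lor y y)}"
    by (intro closed_Collect_conj closed_Collect_le continuous_on_power continuous_on_mult
        continuous_on_minus continuous_on_lor continuous_on_component continuous_on_const continuous_on_id)
  hence "closedin (top_of_set S) (S \<inter> Fut)" unfolding eq by (rule closedin_closed_Int)
  moreover have "openin (top_of_set S) (S \<inter> Fut)" using open_Fut by (rule openin_open_Int)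
  moreover have "connected S" by (simp add: S_def)
  ultimately have "S \<inter> Fut = {} \<or> S \<inter> Fut = S" unfolding connected_clopen by blast
  moreover have "p \<in> S \<inter> Fut" using p by (auto simp: S_def H3_Fut)
  ultimately show ?thesis by (auto simp: S_def)
qed

text \<open>Redundant constraints are discarded one at a time. Taking for \<open>L\<close> the whole
  space yields the facets of a polytope, taking a hyperplane yields the edges of one facet.\<close>

lemma exists_irredundant:
  assumes "finite N"
  obtains M where "M \<subseteq> N" "L \<inter> pcone M = L \<inter> pcone N"
    "\<And>k. k \<in> M \<Longrightarrow> \<exists>z\<in>L. (\<forall>l\<in>M-{k}. lor z l \<le> 0) \<and> lor z k > 0"
  using assms
proof (induction N arbitrary: thesis rule: finite_psubset_induct)
  case (psubset N)
  show ?case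
  proof (cases "\<forall>k\<in>N. \<exists>z\<in>L. (\<forall>l\<in>N-{k}. lor z l \<le> 0) \<and> lor z k > 0")
    case True
    show ?thesis by (rule psubset.prems[of N]) (use True in simp_all)
  next
    case False
    then obtain k where k: "k \<in> N" "\<And>z. z \<in> L \<Longrightarrow> \<forall>l\<in>N-{k}. lor z l \<le> 0 \<Longrightarrow> lor z k \<le> 0"
      by (meson linorder_not_le)
    have eq: "L \<inter> pcone (N - {k}) = L \<inter> pcone N"
      using k by (auto simp: pcone_def)
    have "N - {k} \<subset> N" using k by blast
    then obtain M where M: "M \<subseteq> N - {k}" "L \<inter> pcone M = L \<inter> pcone (N - {k})"
      "\<And>k. k \<in> M \<Longrightarrow> \<exists>z\<in>L. (\<forall>l\<in>M-{k}. lor z l \<le> 0) \<and> lor z k > 0"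
      using psubset.IH by metis
    show ?thesis by (rule psubset.prems[of M]) (use M eq in auto)
  qed
qed

text \<open>The point where the segment from a strictly feasible p to a point violating only k
  crosses the wall of k.\<close>
lemma crossing_point:
  assumes "\<And>l. l \<in> M \<Longrightarrow> lor p l < 0" "k \<in> M" "\<forall>l\<in>M-{k}. lor z l \<le> 0" "lor z k > 0"
    and w: "w = lor z k *\<^sub>R p - lor p k *\<^sub>R z"
  shows "lor w k = 0" "\<And>l. l \<in> M - {k} \<Longrightarrow> lor w l < 0"
proof -
  show "lor w k = 0" by (simp add: w)
  fix l assume l: "l \<in> M - {k}"
  have "lor z k * lor p l < 0" using assms l by (simp add: mult_pos_neg)
  moreover have "lor p k * lor z l \<ge> 0" using assms l by (simp add: mult_nonpos_nonpos less_imp_le)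
  ultimately show "lor w l < 0" by (simp add: w)
qed

text \<open>The cone over a compact polytope: \<open>p\<close> is an interior point, and
  \<open>pcone_Fut\<close> expresses compactness, since the cone meets the light cone only at the
  origin.\<close>

locale cone_polytope =
  fixes N :: "(real^4) set" and p :: "real^4"
  assumes fin: "finite N"
    and unit: "e \<in> N \<Longrightarrow> lor e e = 1"
    and p_H3: "p \<in> H3"
    and p_neg: "e \<in> N \<Longrightarrow> lor p e < 0"
    and pcone_Fut: "z \<in> pcone N \<Longrightarrow> z \<noteq> 0 \<Longrightarrow> z \<in> Fut"
begin

abbreviation "P \<equiv> H3 \<inter> pcone N"

lemma not_spacelike: "z \<in> pcone N \<Longrightarrow> z \<noteq> 0 \<Longrightarrow> \<not> lor z z \<ge> 0"
  using FutD(1)[OF pcone_Fut, of z] by simp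

lemma nz_P: "z \<in> pcone N \<Longrightarrow> z \<noteq> 0 \<Longrightarrow> nz z \<in> P"
  by (simp add: nz_in_H3 nz_pcone pcone_Fut)

lemma mem_hfacet: "x \<in> hfacet P e \<longleftrightarrow> x \<in> P \<and> lor x e = 0"
  by (auto simp: hfacet_def hplane_def)

lemma nz_hfacet: "z \<in> pcone N \<Longrightarrow> z \<noteq> 0 \<Longrightarrow> nz z \<in> hfacet P e \<longleftrightarrow> lor z e = 0"
  using nz_P[of z] lor_nz_sign(2)[OF pcone_Fut, of z e] by (simp add: mem_hfacet)

lemma facet_normalI:
  assumes "f \<in> N" "w \<noteq> 0" "lor w f = 0" "\<And>e. e \<in> N - {f} \<Longrightarrow> lor w e < 0"
  shows "facet_normal P f"
proof -
  have "lor w e \<le> 0" if "e \<in> N" for e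
    using that assms(3) assms(4)[of e] by (cases "e = f") auto
  hence wK: "w \<in> pcone N" by (simp add: pcone_def)
  hence wF: "w \<in> Fut" using assms pcone_Fut by blast
  have "open (\<Inter>e\<in>N-{f}. {x. lor x e < 0})"
    using fin by (intro open_INT ballI open_Collect_less continuous_on_lor continuous_on_id
        continuous_on_const finite_Diff)
  hence "openin (top_of_set (hplane f)) (hplane f \<inter> (\<Inter>e\<in>N-{f}. {x. lor x e < 0}))"
    by (rule openin_open_Int)
  moreover have "nz w \<in> hplane f \<inter> (\<Inter>e\<in>N-{f}. {x. lor x e < 0})"
    using nz_in_H3[OF wF] lor_nz_sign(2)[OF wF, of f] lor_nz_sign(3)[OF wF] assms(3,4)
    unfolding hplane_def by blast
  moreover have "hplane f \<inter> (\<Inter>e\<in>N-{f}. {x. lor x e < 0}) \<subseteq> P"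
  proof
    fix x assume x: "x \<in> hplane f \<inter> (\<Inter>e\<in>N-{f}. {x. lor x e < 0})"
    hence "lor x e \<le> 0" if "e \<in> N" for e
      using that by (cases "e = f") (auto simp: hplane_def less_imp_le)
    thus "x \<in> P" using x by (auto simp: hplane_def pcone_def)
  qed
  ultimately have "\<exists>U. openin (top_of_set (hplane f)) U \<and> U \<noteq> {} \<and> U \<subseteq> P" by blast
  thus ?thesis unfolding facet_normal_def
    using unit[OF assms(1)] pconeD[OF _ assms(1)] by (simp add: halfsp_def subset_iff)
qed

text \<open>By Farkas \<open>e\<close> is a nonnegative combination of normals. One wall
  \<open>k\<close> must contain the whole piece \<open>U\<close> of the facet, and an open piece of
  a plane determines the plane, so \<open>k\<close> is \<open>e\<close> up to sign; \<open>p\<close>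
  fixes the sign.\<close>

lemma facet_normal_in_N:
  assumes "facet_normal P e"
  shows "e \<in> N"
proof -
  obtain U where U: "openin (top_of_set (hplane e)) U" "U \<noteq> {}" "U \<subseteq> P"
    and e: "lor e e = 1" "P \<subseteq> halfsp e"
    using assms by (auto simp: facet_normal_def)
  have UH: "U \<subseteq> hplane e" using U(1) by (rule openin_imp_subset)
  have eK: "lor z e \<le> 0" if "\<And>s. s \<in> N \<Longrightarrow> lor z s \<le> 0" for z
  proof (cases "z = 0")
    case False
    have zK: "z \<in> pcone N" using that by (simp add: pcone_def)
    hence "nz z \<in> halfsp e" using nz_P[OF zK False] e by blast
    hence "lor (nz z) e \<le> 0" by (simp add: halfsp_def del: lor_nz)
    thus ?thesis using lor_nz_sign(1)[OF pcone_Fut[OF zK False]] by blast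
  qed auto
  have hull: "e \<in> convex_cone hull N" by (rule lor_Farkas[OF fin eK])
  \<comment> \<open>If each normal were nonzero at some point of \<open>U\<close>, the sum of these
    points would be strictly negative on all of \<open>N\<close>, hence on \<open>e\<close>,
    although \<open>U\<close> lies in the plane of \<open>e\<close>.\<close>
  obtain k where k: "k \<in> N" "\<And>x. x \<in> U \<Longrightarrow> lor x k = 0"
  proof (rule ccontr)
    assume "\<not> thesis"
    hence "\<forall>k\<in>N. \<exists>x\<in>U. lor x k \<noteq> 0" using that by blast
    then obtain x where x: "\<And>k. k \<in> N \<Longrightarrow> x k \<in> U \<and> lor (x k) k \<noteq> 0" by metis
    have "lor (\<Sum>k\<in>N. x k) l < 0" if "l \<in> N" for l
    proof -
      have "lor (x k) l \<le> 0" if "k \<in> N" for k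
        using x[OF that] U(3) \<open>l \<in> N\<close> by (auto simp: pcone_def)
      moreover have "lor (x l) l < 0" using calculation[OF that] x[OF that] by linarith
      ultimately have "(\<Sum>k\<in>N. lor (x k) l) < (\<Sum>k\<in>N. 0)"
        using fin that by (intro sum_strict_mono_ex1) auto
      thus ?thesis by (simp add: lor_sum_left)
    qed
    hence "lor (\<Sum>k\<in>N. x k) e < 0" using hull e by (intro lor_convex_cone_hull_less[of e N]) auto
    moreover have "lor (\<Sum>k\<in>N. x k) e = 0"
      using x UH by (auto simp: lor_sum_left hplane_def intro!: sum.neutral)
    ultimately show False by simp
  qed
  obtain x where x: "x \<in> U" using U(2) by blast
  have xH: "x \<in> H3" "lor x e = 0" using x UH by (auto simp: hplane_def)
  \<comment> \<open>The part of \<open>k\<close> tangent to the plane of \<open>e\<close>. A small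
    move along it stays in \<open>U\<close>, where \<open>k\<close> vanishes, so \<open>v\<close>
    has square 0; being orthogonal to \<open>x\<close>, it is zero.\<close>
  define v where "v = k - lor k e *\<^sub>R e"
  have ve: "lor v e = 0" using e by (simp add: v_def)
  obtain t where t: "t > 0" "x + t *\<^sub>R v \<in> Fut" "nz (x + t *\<^sub>R v) \<in> U"
  proof (rule openin_perturb[OF U(1) x xH(1)])
    fix t assume t: "x + t *\<^sub>R v \<in> Fut"
    show "nz (x + t *\<^sub>R v) \<in> hplane e"
      using nz_in_H3[OF t] ve xH by (simp add: hplane_def)
  qed
  have "lor (x + t *\<^sub>R v) k = 0" using k(2)[OF t(3)] lor_nz_sign(2)[OF t(2)] by blast
  hence "lor v k = 0" using k(2)[OF x] t(1) by simp
  hence "lor v v = 0" using ve by (simp add: v_def)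
  moreover have "lor v x = 0" using k(2)[OF x] xH by (simp add: v_def lor_commute)
  ultimately have "v = 0" using lor_orthogonal_timelike[of x v] xH by (force simp: H3_def)
  hence ke: "k = lor k e *\<^sub>R e" by (simp add: v_def)
  have "lor k k = (lor k e)\<^sup>2" by (subst ke, subst (2) ke) (simp add: e power2_eq_square)
  hence "(lor k e)\<^sup>2 = 1" using unit[OF k(1)] by simp
  hence "lor k e = 1 \<or> lor k e = -1" by (simp add: power2_eq_1_iff)
  moreover have "lor k e \<noteq> -1"
  proof
    assume "lor k e = -1"
    hence "k = - e" using ke by simp
    hence "lor p e > 0" using p_neg[OF k(1)] by simp
    moreover have "lor p e \<le> 0" by (rule eK) (simp add: p_neg less_imp_le)
    ultimately show False by simp
  qed
  ultimately show ?thesis using ke k(1) by simp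
qed

text \<open>The functional \<open>v\<close> tells the projections of \<open>w\<close> and
  \<open>w'\<close> apart, so the two facets share more than one point.\<close>

lemma adjacentI:
  assumes "facet_normal P j" "facet_normal P k" "hfacet P j \<noteq> hfacet P k"
    and "w \<in> pcone N" "w \<noteq> 0" "lor w j = 0" "lor w k = 0"
    and "w' \<in> pcone N" "lor w' j = 0" "lor w' k = 0" "lor w v = 0" "lor w' v \<noteq> 0"
  shows "adjacent P j k"
proof -
  have w': "w' \<noteq> 0" using assms by auto
  have "lor (nz w) v = 0" "lor (nz w') v \<noteq> 0"
    using assms w' pcone_Fut lor_nz_sign by blast+
  hence "nz w \<noteq> nz w'" by metis
  moreover have "nz w \<in> hfacet P j \<inter> hfacet P k" "nz w' \<in> hfacet P j \<inter> hfacet P k"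
    using assms w' nz_hfacet by auto
  ultimately show ?thesis unfolding adjacent_def using assms by blast
qed

end

section \<open>Acute-angled polytopes\<close>

text \<open>Each wall has a point of the cone on no other wall, so that \<open>N\<close> consists
  exactly of the facet normals.\<close>

locale irredundant_polytope = cone_polytope +
  assumes irredundant: "f \<in> N \<Longrightarrow> \<exists>w. lor w f = 0 \<and> (\<forall>e\<in>N-{f}. lor w e < 0)"
begin

lemma wall_point:
  assumes f: "f \<in> N"
  obtains w where "w \<in> pcone N" "w \<noteq> 0" "lor w f = 0" "\<And>e. e \<in> N - {f} \<Longrightarrow> lor w e < 0"
proof -
  obtain w where w: "lor w f = 0" "\<And>e. e \<in> N - {f} \<Longrightarrow> lor w e < 0"
    using irredundant[OF f] by blast
  have "N - {f} \<noteq> {}"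
  proof
    \<comment> \<open>A cone with the single wall \<open>f\<close> would contain the spacelike
      vector \<open>- f\<close>.\<close>
    assume *: "N - {f} = {}"
    have "lor (- f) e \<le> 0" if "e \<in> N" for e
      using that * unit[OF f] by (cases "e = f") auto
    hence "- f \<in> pcone N" by (simp add: pcone_def)
    moreover have "f \<noteq> 0" using unit[OF f] by auto
    ultimately show False using not_spacelike[of "- f"] unit[OF f] by simp
  qed
  then obtain e where "e \<in> N - {f}" by blast
  hence "w \<noteq> 0" using w(2) by force
  moreover have "lor w e \<le> 0" if "e \<in> N" for e
    using that w(1) w(2)[of e] by (cases "e = f") auto
  hence "w \<in> pcone N" by (simp add: pcone_def)
  ultimately show ?thesis using w that by blast
qed

lemma facet_normal_N: "f \<in> N \<Longrightarrow> facet_normal P f"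
  by (rule wall_point, assumption, rule facet_normalI)

lemma hfacet_neq:
  assumes "j \<in> N" "k \<in> N" "j \<noteq> k" shows "hfacet P j \<noteq> hfacet P k"
proof -
  obtain w where w: "w \<in> pcone N" "w \<noteq> 0" "lor w j = 0" "\<And>e. e \<in> N - {j} \<Longrightarrow> lor w e < 0"
    using wall_point[OF assms(1)] by blast
  have "lor w k < 0" using w(4)[of k] assms by simp
  hence "nz w \<in> hfacet P j" "nz w \<notin> hfacet P k"
    using nz_hfacet[OF w(1,2)] w(3) by auto
  thus ?thesis by blast
qed

lemma adjacent_NI:
  assumes "j \<in> N" "k \<in> N" "j \<noteq> k"
    and "w \<in> pcone N" "w \<noteq> 0" "lor w j = 0" "lor w k = 0"
    and "w' \<in> pcone N" "lor w' j = 0" "lor w' k = 0" "lor w v = 0" "lor w' v \<noteq> 0"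
  shows "adjacent P j k"
  using adjacentI[OF facet_normal_N[OF assms(1)] facet_normal_N[OF assms(2)] hfacet_neq[OF assms(1-3)] assms(4-12)] .

lemma adjacentD:
  assumes "adjacent P j k"
  shows "j \<in> N" "k \<in> N" "j \<noteq> k"
  using assms facet_normal_in_N by (auto simp: adjacent_def)

text \<open>Within the plane of \<open>j\<close> only an irredundant subset \<open>M\<close> of the
  constraints is kept. Each constraint kept is active along a piece of an edge, which gives
  adjacency.\<close>

lemma wall_cut_out_by_adjacent:
  assumes j: "j \<in> N"
  obtains M where "M \<subseteq> N - {j}" "M \<noteq> {}" "\<And>k. k \<in> M \<Longrightarrow> adjacent P j k"
    "\<And>z. lor z j = 0 \<Longrightarrow> (\<And>k. k \<in> M \<Longrightarrow> lor z k \<le> 0) \<Longrightarrow> z \<in> pcone N"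
proof -
  define L where "L = {z. lor z j = 0}"
  obtain M where M: "M \<subseteq> N - {j}" "L \<inter> pcone M = L \<inter> pcone (N - {j})"
    "\<And>k. k \<in> M \<Longrightarrow> \<exists>z\<in>L. (\<forall>l\<in>M-{k}. lor z l \<le> 0) \<and> lor z k > 0"
    by (rule exists_irredundant[of "N - {j}" L]) (use fin in auto)
  have cut: "z \<in> pcone N" if z: "lor z j = 0" "\<And>k. k \<in> M \<Longrightarrow> lor z k \<le> 0" for z
  proof -
    have "z \<in> L \<inter> pcone M" using z by (auto simp: L_def pcone_def)
    hence "z \<in> pcone (N - {j})" using M(2) by blast
    hence "lor z e \<le> 0" if "e \<in> N" for e
      using that z(1) by (cases "e = j") (auto simp: pcone_def)
    thus ?thesis by (simp add: pcone_def)
  qed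
  \<comment> \<open>With at most one constraint left, a vector orthogonal to \<open>j\<close> and
    \<open>p\<close>, with suitable sign, would be a spacelike element of the cone. This also makes
    \<open>w\<close> below nonzero.\<close>
  have not_single: "\<not> M \<subseteq> {k}" for k
  proof
    assume Mk: "M \<subseteq> {k}"
    obtain v where v: "v \<noteq> 0" "lor v j = 0" "lor v p = 0" using exists_lor_orthogonal by metis
    define v' where "v' = (if lor v k \<le> 0 then v else - v)"
    have "v' \<in> pcone N" by (rule cut) (use v Mk in \<open>auto simp: v'_def\<close>)
    moreover have "lor v' v' > 0" "v' \<noteq> 0"
      using lor_orthogonal_timelike[of p v] v p_H3 by (auto simp: v'_def H3_def)
    ultimately show False using not_spacelike by fastforce
  qed
  obtain q where q: "q \<in> pcone N" "lor q j = 0" "\<And>e. e \<in> N - {j} \<Longrightarrow> lor q e < 0"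
    using wall_point[OF j] by blast
  have adj: "adjacent P j k" if k: "k \<in> M" for k
  proof -
    obtain z where z: "lor z j = 0" "\<forall>l\<in>M-{k}. lor z l \<le> 0" "lor z k > 0"
      using M(3)[OF k] by (auto simp: L_def)
    define w where "w = lor z k *\<^sub>R q - lor q k *\<^sub>R z"
    have w: "lor w k = 0" "\<And>l. l \<in> M - {k} \<Longrightarrow> lor w l < 0"
      using crossing_point[of M q k z w] q(3) M(1) z k w_def by blast+
    have wj: "lor w j = 0" using q z by (simp add: w_def)
    have "M - {k} \<noteq> {}" using not_single[of k] by blast
    hence w0: "w \<noteq> 0" using w(2) by force
    have wK: "w \<in> pcone N" by (rule cut[OF wj]) (use w in \<open>force simp: less_imp_le\<close>)
    \<comment> \<open>\<open>v\<close> is tangent to the common line of the two walls, so a small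
      step along it gives a second point of the edge.\<close>
    obtain v where v: "v \<noteq> 0" "lor v j = 0" "lor v k = 0" "lor v w = 0"
      using exists_lor_orthogonal by blast
    obtain \<epsilon> where \<epsilon>: "\<epsilon> > 0" "\<And>l. l \<in> M - {k} \<Longrightarrow> lor (w + \<epsilon> *\<^sub>R v) l < 0"
      using lor_perturb_neg[of "M - {k}" w v] w(2) finite_subset[OF M(1)] fin by blast
    have "w + \<epsilon> *\<^sub>R v \<in> pcone N"
    proof (rule cut)
      show "lor (w + \<epsilon> *\<^sub>R v) j = 0" using wj v by simp
      show "lor (w + \<epsilon> *\<^sub>R v) l \<le> 0" if "l \<in> M" for l
        using that w(1) v(3) \<epsilon>(2)[of l] by (cases "l = k") auto
    qed
    moreover have "lor v v > 0"
      using lor_orthogonal_timelike[OF FutD(1)[OF pcone_Fut[OF wK w0]]] v by blast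
    ultimately show ?thesis
      using adjacent_NI[of j k w "w + \<epsilon> *\<^sub>R v" v] j k M(1) wK w0 wj w(1) v \<epsilon>(1)
      by (auto simp: lor_commute[of w v])
  qed
  show ?thesis by (rule that[of M]) (use M(1) adj cut not_single in blast)+
qed

end

locale acute_polytope = irredundant_polytope +
  assumes acute: "adjacent P j k \<Longrightarrow> lor j k \<le> 0"
begin

text \<open>On the facet cone of j the functional i is nonpositive, so by Farkas i is
  a multiple of j plus a nonnegative combination y of neighbours of j; a positive multiple
  would force the facet of i into the plane of j.\<close>
lemma lor_nonpos:
  assumes i: "i \<in> N" and j: "j \<in> N" and "i \<noteq> j"
  shows "lor i j \<le> 0"
proof -
  obtain M where M: "M \<subseteq> N - {j}" "\<And>k. k \<in> M \<Longrightarrow> adjacent P j k"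
    "\<And>z. lor z j = 0 \<Longrightarrow> (\<And>k. k \<in> M \<Longrightarrow> lor z k \<le> 0) \<Longrightarrow> z \<in> pcone N"
    by (rule wall_cut_out_by_adjacent[OF j]) blast
  have "i \<in> convex_cone hull ({j, - j} \<union> M)"
  proof (rule lor_Farkas)
    show "finite ({j, - j} \<union> M)" using finite_subset[OF M(1)] fin by simp
    fix z assume z: "\<And>s. s \<in> {j, - j} \<union> M \<Longrightarrow> lor z s \<le> 0"
    have "z \<in> pcone N"
    proof (rule M(3))
      show "lor z j = 0" using z[of j] z[of "- j"] by simp
    qed (use z in blast)
    thus "lor z i \<le> 0" using i by (rule pconeD)
  qed
  then obtain x y where xy: "x \<in> convex_cone hull {j, - j}" "y \<in> convex_cone hull M" "i = x + y"
    unfolding convex_cone_hull_Un by auto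
  have "convex_cone (span {j})" by (simp add: convex_cone_iff span_add span_scale span_zero)
  moreover have "{j, - j} \<subseteq> span {j}" by (simp add: span_base span_neg)
  ultimately have "convex_cone hull {j, - j} \<subseteq> span {j}" by (intro hull_minimal)
  then obtain c where c: "i = c *\<^sub>R j + y" using xy by (auto simp: span_singleton)
  have "lor j y \<le> 0" by (rule lor_convex_cone_hull_le[OF xy(2)]) (use acute M(2) in blast)
  hence yj: "lor y j \<le> 0" by (simp add: lor_commute)
  have "c \<le> 0"
  proof (rule ccontr)
    assume "\<not> c \<le> 0"
    obtain w where w: "w \<in> pcone N" "lor w i = 0" "\<And>e. e \<in> N - {i} \<Longrightarrow> lor w e < 0"
      using wall_point[OF i] by blast
    have "lor w j < 0" using w(3)[of j] j assms(3) by blast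
    hence "c * lor w j < 0" using \<open>\<not> c \<le> 0\<close> by (simp add: mult_pos_neg)
    moreover have "lor w y \<le> 0"
      by (rule lor_convex_cone_hull_le[OF xy(2)]) (use M(1) w(1) pconeD in blast)
    ultimately show False using w(2) by (simp add: c)
  qed
  thus ?thesis using yj unit[OF j] by (simp add: c)
qed

text \<open>A linear relation is split into its positive part \<open>x\<close> and negative part
  \<open>y\<close>. As \<open>x = y\<close>, the square of \<open>x\<close> is the pairing of both
  parts, which is nonpositive by \<open>lor_nonpos\<close>. Being orthogonal to \<open>V\<close>,
  \<open>x\<close> is then 0, and pairing with \<open>p\<close> shows that no coefficient is
  positive.\<close>

lemma independent_walls:
  assumes A: "A \<subseteq> N" and V: "V \<in> Fut" "\<And>a. a \<in> A \<Longrightarrow> lor a V = 0"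
  shows "independent A"
proof (rule ccontr)
  have finA: "finite A" using A fin finite_subset by blast
  assume "\<not> independent A"
  then obtain u where u: "(\<Sum>a\<in>A. u a *\<^sub>R a) = 0" "\<exists>a\<in>A. u a \<noteq> 0"
    using dependent_finite[OF finA] by blast
  have *: "u a \<le> 0" if sum0: "(\<Sum>a\<in>A. u a *\<^sub>R a) = 0" and a: "a \<in> A" for u a
  proof (rule ccontr)
    assume ua: "\<not> u a \<le> 0"
    define x where "x = (\<Sum>a\<in>A. max (u a) 0 *\<^sub>R a)"
    define y where "y = (\<Sum>a\<in>A. max (- u a) 0 *\<^sub>R a)"
    have "x - y = (\<Sum>a\<in>A. u a *\<^sub>R a)"
      unfolding x_def y_def sum_subtractf[symmetric]
      by (intro sum.cong refl) (auto simp: scaleR_left_diff_distrib[symmetric] max_def)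
    hence "x = y" using sum0 by simp
    have "lor x x = (\<Sum>a\<in>A. \<Sum>b\<in>A. max (- u a) 0 * (max (u b) 0 * lor b a))"
      by (subst (2) \<open>x = y\<close>) (simp add: x_def y_def lor_sum_left lor_sum_right sum_distrib_left)
    also have "\<dots> \<le> 0"
    proof (intro sum_nonpos)
      fix a b assume "a \<in> A" "b \<in> A"
      show "max (- u a) 0 * (max (u b) 0 * lor b a) \<le> 0"
      proof (cases "a = b")
        case True thus ?thesis by (auto simp: max_def)
      next
        case False
        hence "lor b a \<le> 0" using lor_nonpos A \<open>a \<in> A\<close> \<open>b \<in> A\<close> by blast
        thus ?thesis by (intro mult_nonneg_nonpos) auto
      qed
    qed
    finally have "lor x x \<le> 0" .
    moreover have "lor x V = 0" using V(2) by (simp add: x_def lor_sum_left)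
    ultimately have "x = 0" using lor_orthogonal_timelike[OF FutD(1)[OF V(1)], of x] by fastforce
    moreover have "lor x p < 0"
    proof -
      have "(\<Sum>a\<in>A. max (u a) 0 * lor a p) < (\<Sum>a\<in>A. 0)"
      proof (rule sum_strict_mono_ex1[OF finA])
        show "\<forall>b\<in>A. max (u b) 0 * lor b p \<le> 0"
          using p_neg A by (auto intro!: mult_nonneg_nonpos simp: lor_commute[of _ p] less_imp_le subset_iff)
        show "\<exists>b\<in>A. max (u b) 0 * lor b p < 0"
          using ua a p_neg[of a] A by (intro bexI[of _ a]) (auto intro!: mult_pos_neg simp: lor_commute[of _ p])
      qed
      thus ?thesis by (simp add: x_def lor_sum_left)
    qed
    ultimately show False by simp
  qed
  have "(\<Sum>a\<in>A. (- u a) *\<^sub>R a) = 0" using u(1) by (simp add: sum_negf)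
  hence "\<forall>a\<in>A. u a = 0" using *[OF u(1)] *[of "\<lambda>a. - u a"] by force
  thus False using u(2) by blast
qed

text \<open>The sum of two points of the edge works: a further wall active there contains both
  points, giving three independent normals orthogonal to two independent vectors in dimension
  four.\<close>

lemma edge_interior:
  assumes adj: "adjacent P j k"
  obtains w where "w \<in> pcone N" "w \<noteq> 0" "lor w j = 0" "lor w k = 0"
    "\<And>l. l \<in> N - {j,k} \<Longrightarrow> lor w l < 0"
proof -
  note jk = adjacentD[OF adj]
  obtain x y where xy: "x \<noteq> y" "x \<in> P" "y \<in> P" "lor x j = 0" "lor x k = 0" "lor y j = 0" "lor y k = 0"
    using adj by (auto simp: adjacent_def mem_hfacet)
  have w: "x + y \<in> pcone N" "x + y \<in> Fut" using xy by (auto simp: pcone_add Fut_add H3_Fut)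
  have ind: "independent {x, y}"
  proof -
    have "x \<noteq> c *\<^sub>R y" for c
    proof
      assume c: "x = c *\<^sub>R y"
      hence "c\<^sup>2 = 1" using xy by (auto simp: H3_def power2_eq_square)
      moreover have "c > 0" using c xy by (auto simp: H3_def zero_less_mult_iff)
      ultimately show False using xy(1) c by (simp add: power2_eq_1_iff)
    qed
    moreover have "y \<noteq> 0" using xy by (auto simp: H3_def)
    ultimately show ?thesis using xy(1)
      by (auto simp: independent_insert dependent_single span_singleton)
  qed
  have "lor (x + y) l < 0" if l: "l \<in> N - {j,k}" for l
  proof (rule ccontr)
    assume "\<not> ?thesis"
    moreover have "lor x l \<le> 0" "lor y l \<le> 0" using xy l by (auto simp: pcone_def)
    ultimately have l0: "lor x l = 0" "lor y l = 0" by auto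
    have "independent {j,k,l}"
      by (rule independent_walls[of _ x]) (use jk l l0 xy H3_Fut lor_commute in auto)
    hence "card {j,k,l} + card {x,y} \<le> 4"
      by (rule card_orthogonal_independent_le[OF _ ind]) (use l0 xy lor_commute in auto)
    thus False using jk l xy(1) by auto
  qed
  thus ?thesis using that[of "x + y"] w xy FutD(3) by simp
qed

text \<open>The spacelike direction \<open>u\<close> is not in the cone, so some wall stops the ray
  from \<open>w\<close> along \<open>u\<close>; the first one reached gives the vertex.\<close>

lemma edge_endpoint:
  assumes w: "w \<in> pcone N" "w \<noteq> 0" "\<And>l. l \<in> N - {j,k} \<Longrightarrow> lor w l < 0"
    and u: "u \<noteq> 0" "lor u j = 0" "lor u k = 0" "lor u w = 0"
    and wjk: "lor w j = 0" "lor w k = 0"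
  obtains t e where "t > 0" "e \<in> N - {j,k}" "lor u e > 0" "w + t *\<^sub>R u \<in> pcone N"
    "lor (w + t *\<^sub>R u) e = 0"
proof -
  define A where "A = {e \<in> N. lor u e > 0}"
  have finA: "finite A" using fin by (simp add: A_def)
  have "lor u u > 0" using lor_orthogonal_timelike[of w u] w u pcone_Fut FutD(1) by blast
  hence "u \<notin> pcone N" using not_spacelike[of u] u(1) by fastforce
  hence "A \<noteq> {}" by (auto simp: A_def pcone_def not_le)
  \<comment> \<open>The parameter at which the ray crosses the wall of \<open>e\<close>.\<close>
  define r where "r e = - lor w e / lor u e" for e
  define e where "e = arg_min_on r A"
  have e: "e \<in> A" "\<And>a. a \<in> A \<Longrightarrow> r e \<le> r a"
    using arg_min_if_finite[OF finA \<open>A \<noteq> {}\<close>, of r] by (auto simp: e_def not_less)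
  have eN: "e \<in> N - {j,k}" "lor u e > 0" using e(1) u by (auto simp: A_def)
  have r: "r e > 0" using w(3)[OF eN(1)] eN(2) unfolding r_def by (intro divide_pos_pos) auto
  have "lor (w + r e *\<^sub>R u) l \<le> 0" if l: "l \<in> N" for l
  proof (cases "lor u l > 0")
    case True
    hence "r e * lor u l \<le> r l * lor u l" using e(2)[of l] l by (simp add: A_def)
    also have "\<dots> = - lor w l" using True by (simp add: r_def)
    finally show ?thesis by simp
  next
    case False
    have "r e * lor u l \<le> 0" using False r by (intro mult_nonneg_nonpos) auto
    thus ?thesis using pconeD[OF w(1) l] by simp
  qed
  hence "w + r e *\<^sub>R u \<in> pcone N" by (simp add: pcone_def)
  moreover have "lor (w + r e *\<^sub>R u) e = 0" using eN(2) by (simp add: r_def)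
  ultimately show ?thesis using that r eN by blast
qed

text \<open>Vertices are simple: a fourth wall through \<open>V\<close> would give four independent
  normals orthogonal to \<open>V\<close>. One can therefore leave \<open>V\<close> along the line of
  \<open>a\<close> and \<open>c\<close>, on the inner side of \<open>b\<close>, without leaving the
  cone.\<close>

lemma adjacent_at_vertex:
  assumes abc: "a \<in> N" "b \<in> N" "c \<in> N" "a \<noteq> b" "a \<noteq> c" "b \<noteq> c"
    and V: "V \<in> pcone N" "V \<noteq> 0" "lor V a = 0" "lor V b = 0" "lor V c = 0"
  shows "adjacent P a c"
proof -
  note VF = pcone_Fut[OF V(1,2)]
  have strict: "lor V l < 0" if l: "l \<in> N - {a,b,c}" for l
  proof (rule ccontr)
    assume "\<not> ?thesis"
    hence l0: "lor V l = 0" using pconeD[OF V(1), of l] l by force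
    have "independent {a,b,c,l}"
      by (rule independent_walls[OF _ VF]) (use abc V l l0 lor_commute in auto)
    hence "card {a,b,c,l} + card {V} \<le> 4"
      by (rule card_orthogonal_independent_le) (use V l0 lor_commute in auto)
    thus False using abc l by auto
  qed
  obtain v where v: "v \<noteq> 0" "lor v a = 0" "lor v c = 0" "lor v V = 0"
    using exists_lor_orthogonal by blast
  have vv: "lor v v > 0" using lor_orthogonal_timelike[OF FutD(1)[OF VF]] v by blast
  \<comment> \<open>Otherwise three independent normals would be orthogonal to both \<open>v\<close>
    and \<open>V\<close>.\<close>
  have "lor v b \<noteq> 0"
  proof
    assume vb: "lor v b = 0"
    have "v \<noteq> s *\<^sub>R V" for s
      using v(4) v(1) FutD(1)[OF VF] by auto
    hence ind: "independent {v, V}"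
      using V(2) by (auto simp: independent_insert dependent_single span_singleton)
    have "independent {a,b,c}"
      by (rule independent_walls[OF _ VF]) (use abc V lor_commute in auto)
    hence "card {a,b,c} + card {v,V} \<le> 4"
      by (rule card_orthogonal_independent_le[OF _ ind]) (use V v vb lor_commute in auto)
    moreover have "v \<noteq> V" using \<open>\<And>s. v \<noteq> s *\<^sub>R V\<close>[of 1] by simp
    ultimately show False using abc by auto
  qed
  define v' where "v' = (if lor v b < 0 then v else - v)"
  have v': "lor v' a = 0" "lor v' b < 0" "lor v' c = 0" "lor v' V = 0" "lor v' v' > 0"
    using v vv \<open>lor v b \<noteq> 0\<close> by (auto simp: v'_def)
  obtain \<epsilon> where \<epsilon>: "\<epsilon> > 0" "\<And>l. l \<in> N - {a,b,c} \<Longrightarrow> lor (V + \<epsilon> *\<^sub>R v') l < 0"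
    using lor_perturb_neg[of "N - {a,b,c}" V v'] strict fin by blast
  have "lor (V + \<epsilon> *\<^sub>R v') l \<le> 0" if l: "l \<in> N" for l
  proof (cases "l \<in> {a,b,c}")
    case True
    thus ?thesis using V v' \<epsilon>(1) by (auto simp: mult_nonneg_nonpos)
  next
    case False
    thus ?thesis using \<epsilon>(2)[of l] l by simp
  qed
  hence "V + \<epsilon> *\<^sub>R v' \<in> pcone N" by (simp add: pcone_def)
  thus ?thesis
    using adjacent_NI[of a c V "V + \<epsilon> *\<^sub>R v'" v'] abc V v' \<epsilon>(1) by (auto simp: lor_commute[of V v'])
qed

end

section \<open>Estimates at a vertex\<close>

lemma sin_pi_fifth_pos: "sin (pi / 5) > 0"
  by (rule sin_gt_zero) auto

text \<open>\<open>sin (2 * x) = sin (3 * x)\<close> at \<open>x = pi / 5\<close> yields a quadratic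
  equation for the cosine; comparison with \<open>cos (pi / 3)\<close> selects the root.\<close>

lemma cos_pi_fifth: "cos (pi / 5) = (1 + sqrt 5) / 4"
proof -
  let ?c = "cos (pi / 5)" and ?s = "sin (pi / 5)"
  have "sin (2 * (pi/5)) = sin (pi - 2 * (pi/5))" by (simp only: sin_pi_minus)
  also have "pi - 2 * (pi/5) = 2 * (pi/5) + pi/5" by simp
  finally have "sin (2 * (pi/5)) = sin (2 * (pi/5) + pi/5)" .
  hence "2 * ?s * ?c = 2 * ?s * ?c * ?c + (2 * ?c\<^sup>2 - 1) * ?s"
    unfolding sin_add sin_double cos_double_cos by simp
  hence "?s * (4 * ?c\<^sup>2 - 2 * ?c - 1) = 0" by (simp add: algebra_simps power2_eq_square)
  hence "4 * ?c\<^sup>2 - 2 * ?c - 1 = 0" using sin_pi_fifth_pos by simp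
  hence "(4 * ?c - 1)\<^sup>2 = 5" by (simp add: power2_eq_square algebra_simps)
  moreover have "?c \<ge> cos (pi/3)" by (rule cos_monotone_0_pi_le) auto
  hence "4 * ?c - 1 \<ge> 0" by (simp add: cos_60)
  ultimately have "sqrt 5 = 4 * ?c - 1" by (rule real_sqrt_unique)
  thus ?thesis by simp
qed

definition coxeter_cos :: "real \<Rightarrow> bool" where
  "coxeter_cos c \<longleftrightarrow> (\<exists>k::nat. k \<ge> 2 \<and> c = cos (pi / real k))"

lemma cos_pi_div_mono:
  assumes "2 \<le> m" "m \<le> k" shows "cos (pi / real m) \<le> cos (pi / real k)"
proof (rule cos_monotone_0_pi_le)
  show "pi / real k \<le> pi / real m" using assms by (intro divide_left_mono) auto
  show "pi / real m \<le> pi" using assms by (simp add: field_simps)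
qed auto

text \<open>The cosines for \<open>k = 2\<close> and \<open>k = 3\<close> are isolated, and from
  \<open>k = 4\<close> on the square is at least 1/2. A square below 3/4 excludes \<open>k\<close>
  from 6 on, leaving at most \<open>cos (pi / 5)\<close>, rounded up.\<close>

lemma coxeter_cosD:
  assumes "coxeter_cos c"
  shows "0 \<le> c" "c < 1" "c = 0 \<or> c = 1/2 \<or> c\<^sup>2 \<ge> 1/2" "c\<^sup>2 < 3/4 \<Longrightarrow> c \<le> 8091/10000"
proof -
  obtain k where k: "k \<ge> 2" "c = cos (pi / real k)" using assms by (auto simp: coxeter_cos_def)
  show c0: "0 \<le> c" using cos_pi_div_mono[of 2 k] k by simp
  have "cos (pi / real k) < cos 0" using k by (intro cos_monotone_0_pi) (auto simp: field_simps)
  thus "c < 1" using k by simp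
  show "c = 0 \<or> c = 1/2 \<or> c\<^sup>2 \<ge> 1/2"
  proof -
    consider "k = 2" | "k = 3" | "k \<ge> 4" using k by linarith
    thus ?thesis
    proof cases
      case 3
      hence "sqrt 2 / 2 \<le> c" using cos_pi_div_mono[of 4 k] k by (simp add: cos_45)
      hence "(sqrt 2 / 2)\<^sup>2 \<le> c\<^sup>2" by (intro power_mono) auto
      thus ?thesis by (simp add: power_divide)
    qed (use k in \<open>simp_all add: cos_60\<close>)
  qed
  assume c34: "c\<^sup>2 < 3/4"
  have "\<not> k \<ge> 6"
  proof
    assume "k \<ge> 6"
    hence "sqrt 3 / 2 \<le> c" using cos_pi_div_mono[of 6 k] k by (simp add: cos_30)
    hence "(sqrt 3 / 2)\<^sup>2 \<le> c\<^sup>2" by (intro power_mono) auto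
    thus False using c34 by (simp add: power_divide)
  qed
  hence "c \<le> (1 + sqrt 5) / 4" using cos_pi_div_mono[of k 5] k cos_pi_fifth by simp
  moreover have "sqrt 5 \<le> 22361/10000" by (rule real_le_lsqrt) (auto simp: power2_eq_square)
  ultimately show "c \<le> 8091/10000" by simp
qed

text \<open>h1, h2, h3 are the hyperbolic sines of the distances from the interior point to three facets at
  a vertex, and c, a, b the cosines of their dihedral angles 12, 13, 23. Then \<open>edge_dist\<close> is the squared
  hyperbolic sine of the distance to the line of the edge 12, \<open>foot\<close> is, up to scaling, the hyperbolic
  sine of the distance from its nearest point to the vertex, and \<open>apex\<close> is the squared sine of the
  angle between this line and the third facet.\<close>

definition edge_dist :: "real \<Rightarrow> real \<Rightarrow> real \<Rightarrow> real" where
  "edge_dist c h1 h2 = (h1\<^sup>2 + h2\<^sup>2 + 2 * c * h1 * h2) / (1 - c\<^sup>2)"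

definition foot :: "real \<Rightarrow> real \<Rightarrow> real \<Rightarrow> real \<Rightarrow> real \<Rightarrow> real \<Rightarrow> real" where
  "foot c a b h1 h2 h3 = h3 + ((h1 + c * h2) * a + (h2 + c * h1) * b) / (1 - c\<^sup>2)"

definition apex :: "real \<Rightarrow> real \<Rightarrow> real \<Rightarrow> real" where
  "apex c a b = 1 - (a\<^sup>2 + b\<^sup>2 + 2 * c * a * b) / (1 - c\<^sup>2)"

lemma edge_dist_commute: "edge_dist c h1 h2 = edge_dist c h2 h1"
  by (simp add: edge_dist_def algebra_simps)

lemma foot_swap: "foot c a b h1 h2 h3 = foot c b a h2 h1 h3"
  by (simp add: foot_def algebra_simps)

lemma apex_swap: "apex c a b = apex c b a"
  by (simp add: apex_def algebra_simps)

lemma foot_pos: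
  assumes "0 \<le> c" "c < 1" "0 \<le> a" "0 \<le> b" "0 < h1" "0 < h2" "0 < h3"
  shows "foot c a b h1 h2 h3 > 0"
proof -
  have "c\<^sup>2 < 1" using assms by (simp add: power_less_one_iff)
  thus ?thesis unfolding foot_def using assms by (intro add_pos_nonneg divide_nonneg_pos) auto
qed

text \<open>The comparison takes place in facet 1, between its edges 12 and 13. Here
  \<open>(b + c * a) / (s * s')\<close> is the cosine of the angle \<theta> of that facet at the
  vertex, so \<open>B\<close> bounds \<open>s' * (1 + cos \<theta>)\<close>; divided by
  \<open>s' * sin \<theta>\<close>, the square root of \<open>apex\<close>, this becomes
  \<open>cot (\<theta> / 2)\<close>.\<close>

lemma foot_le:
  assumes c: "0 \<le> c" "c < 1" and a: "0 \<le> a" "a < 1" and b: "0 \<le> b"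
    and h: "0 < h1" "0 < h2" "0 < h3" and le: "edge_dist a h1 h3 \<le> edge_dist c h1 h2"
    and B: "sqrt (1 - a\<^sup>2) + (b + c * a) / sqrt (1 - c\<^sup>2) \<le> B"
  shows "(foot c a b h1 h2 h3)\<^sup>2 \<le> B\<^sup>2 * edge_dist c h1 h2"
proof -
  define s where "s = sqrt (1 - c\<^sup>2)"
  define s' where "s' = sqrt (1 - a\<^sup>2)"
  define r where "r = (h2 + c * h1) / s"
  define D where "D = edge_dist c h1 h2"
  have c2: "c\<^sup>2 < 1" and a2: "a\<^sup>2 < 1" using c a by (simp_all add: power_less_one_iff)
  have s: "s > 0" "s\<^sup>2 = 1 - c\<^sup>2" and s': "s' > 0" "s'\<^sup>2 = 1 - a\<^sup>2"
    using c2 a2 by (simp_all add: s_def s'_def)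
  have r: "r > 0" using c h s by (simp add: r_def add_pos_nonneg)
  \<comment> \<open>\<open>D\<close> splits into a part normal to facet 1 and a part inside it. Both
    edges share the normal part, so comparing them leaves only the parts inside.\<close>
  have D: "D = h1\<^sup>2 + r\<^sup>2"
  proof -
    have "h1\<^sup>2 + h2\<^sup>2 + 2 * c * h1 * h2 = h1\<^sup>2 * s\<^sup>2 + (h2 + c * h1)\<^sup>2"
      unfolding s(2) by (simp add: power2_eq_square algebra_simps)
    hence "D = (h1\<^sup>2 * s\<^sup>2 + (h2 + c * h1)\<^sup>2) / s\<^sup>2" by (simp add: D_def edge_dist_def s(2))
    also have "\<dots> = h1\<^sup>2 + (h2 + c * h1)\<^sup>2 / s\<^sup>2" using s(1) by (subst add_divide_distrib) simp
    finally show ?thesis by (simp only: r_def power_divide)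
  qed
  have "(h3 + a * h1)\<^sup>2 + h1\<^sup>2 * s'\<^sup>2 = edge_dist a h1 h3 * s'\<^sup>2"
  proof -
    have "edge_dist a h1 h3 * s'\<^sup>2 = h1\<^sup>2 + h3\<^sup>2 + 2 * a * h1 * h3"
      using s'(1) by (simp add: edge_dist_def s'(2)[symmetric])
    thus ?thesis unfolding s'(2) by (simp add: power2_eq_square algebra_simps)
  qed
  also have "\<dots> \<le> D * s'\<^sup>2" using le by (simp add: D_def mult_right_mono)
  also have "\<dots> = h1\<^sup>2 * s'\<^sup>2 + (s' * r)\<^sup>2" unfolding D by (simp add: power_mult_distrib distrib_right)
  finally have "(h3 + a * h1)\<^sup>2 \<le> (s' * r)\<^sup>2" by simp
  hence h3: "h3 + a * h1 \<le> s' * r"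
    by (rule power2_le_imp_le) (use s'(1) r in \<open>simp add: less_imp_le\<close>)
  have "foot c a b h1 h2 h3 = h3 + a * h1 + r * ((b + c * a) / s)"
  proof -
    have "((h1 + c * h2) * a + (h2 + c * h1) * b) = a * h1 * s\<^sup>2 + (h2 + c * h1) * (b + c * a)"
      unfolding s(2) by (simp add: power2_eq_square algebra_simps)
    hence "((h1 + c * h2) * a + (h2 + c * h1) * b) / s\<^sup>2 = a * h1 + r * ((b + c * a) / s)"
      using s(1) by (simp add: add_divide_distrib[of "a * h1 * (s * s)"] r_def power2_eq_square)
    thus ?thesis by (simp add: foot_def s(2)[symmetric])
  qed
  also have "\<dots> \<le> r * (s' + (b + c * a) / s)" using h3 by (simp add: distrib_left mult.commute)
  also have "\<dots> \<le> r * B" using r B by (intro mult_left_mono) (auto simp: s_def s'_def)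
  finally have "foot c a b h1 h2 h3 \<le> r * B" .
  hence "(foot c a b h1 h2 h3)\<^sup>2 \<le> (r * B)\<^sup>2"
    using foot_pos[OF c a(1) b h] by (intro power_mono) auto
  also have "\<dots> = B\<^sup>2 * r\<^sup>2" by (simp add: power_mult_distrib)
  also have "\<dots> \<le> B\<^sup>2 * D" unfolding D by (rule mult_left_mono) auto
  finally show ?thesis by (simp add: D_def)
qed

lemma sqrt3_bound: "1/2 \<le> a \<Longrightarrow> sqrt (1 - a\<^sup>2) \<le> 8661/10000"
proof (rule real_le_lsqrt)
  assume "1/2 \<le> a"
  hence "(1/2)\<^sup>2 \<le> a\<^sup>2" by (intro power_mono) auto
  thus "1 - a\<^sup>2 \<le> (8661/10000)\<^sup>2" by (simp add: power2_eq_square)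
qed auto

text \<open>A positive \<open>apex\<close> with \<open>a\<close> at least 1/2 makes
  \<open>c\<^sup>2\<close> less than 3/4, so \<open>c\<close> is at most about
  \<open>cos (pi / 5)\<close>. The tight case is \<open>y = 1\<close>, where the square is about
  2.806; hence 281/100. Half of \<open>apex\<close> is subtracted so that it cancels in
  \<open>framing_bound\<close>.\<close>

lemma vertex_bound_right_angle:
  assumes cox: "coxeter_cos c" "coxeter_cos a" and "1/2 \<le> a" and pos: "apex c a 0 > 0"
    and h: "0 < h1" "0 < h2" "0 < h3" and le: "edge_dist a h1 h3 \<le> edge_dist c h1 h2"
  shows "(foot c a 0 h1 h2 h3)\<^sup>2 \<le> (281/100 - apex c a 0 / 2) * edge_dist c h1 h2"
proof -
  note c = coxeter_cosD[OF cox(1)] and a = coxeter_cosD[OF cox(2)]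
  have c2: "c\<^sup>2 < 1" using c by (simp add: power_less_one_iff)
  define s where "s = sqrt (1 - c\<^sup>2)"
  have s: "s > 0" "s\<^sup>2 = 1 - c\<^sup>2" using c2 by (simp_all add: s_def)
  define y where "y = a / s"
  have y0: "y \<ge> 0" using a(1) s by (simp add: y_def)
  have ap: "apex c a 0 = 1 - y\<^sup>2" by (simp add: apex_def y_def power_divide s(2))
  hence y1: "y \<le> 1" using pos y0 by (smt (verit) one_le_power)
  have "a\<^sup>2 < 1 - c\<^sup>2" using pos c2 by (simp add: apex_def)
  moreover have "(1/2)\<^sup>2 \<le> a\<^sup>2" using assms(3) by (intro power_mono) auto
  ultimately have "c \<le> 8091/10000" using c(4) by (simp add: power2_eq_square)
  hence cy: "c * y \<le> 8091/10000 * y" using y0 by (rule mult_right_mono)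
  have "(foot c a 0 h1 h2 h3)\<^sup>2 \<le> (8661/10000 + 8091/10000 * y)\<^sup>2 * edge_dist c h1 h2"
    by (rule foot_le[OF c(1,2) a(1,2) order_refl h le])
      (use sqrt3_bound[OF assms(3)] cy in \<open>simp add: y_def s_def\<close>)
  also have "\<dots> \<le> (281/100 - apex c a 0 / 2) * edge_dist c h1 h2"
  proof (rule mult_right_mono)
    have "y\<^sup>2 \<le> y" using y0 y1 by (simp add: mult_left_le power2_eq_square)
    moreover have "(8661/10000 + 8091/10000 * y)\<^sup>2
      = 75012921/100000000 + 140152302/100000000 * y + 65464281/100000000 * y\<^sup>2"
      by (simp add: power2_eq_square algebra_simps)
    moreover have "75012921/100000000 + 140152302/100000000 * y + 65464281/100000000 * y\<^sup>2
      \<le> 281/100 - (1 - y\<^sup>2) / 2" 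
    proof -
      have "140152302 * y + 15464281 * y\<^sup>2 \<le> 155987079" using y1 \<open>y\<^sup>2 \<le> y\<close> by linarith
      thus ?thesis by (simp add: field_simps)
    qed
    ultimately show "(8661/10000 + 8091/10000 * y)\<^sup>2 \<le> 281/100 - apex c a 0 / 2"
      unfolding ap by simp
    show "edge_dist c h1 h2 \<ge> 0" unfolding edge_dist_def using c h c2 by (intro divide_nonneg_pos) auto
  qed
  finally show ?thesis .
qed

text \<open>With \<open>c = 0\<close> and \<open>b = 1/2\<close> the bound in \<open>foot_le\<close>
  is at most 0.8661 + 0.5, well inside the target.\<close>

lemma vertex_bound_half:
  assumes cox: "coxeter_cos a" and "1/2 \<le> a" and pos: "apex 0 a (1/2) > 0"
    and h: "0 < h1" "0 < h2" "0 < h3" and le: "edge_dist a h1 h3 \<le> edge_dist 0 h1 h2"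
  shows "(foot 0 a (1/2) h1 h2 h3)\<^sup>2 \<le> (281/100 - apex 0 a (1/2) / 2) * edge_dist 0 h1 h2"
proof -
  note a = coxeter_cosD[OF cox]
  have "(foot 0 a (1/2) h1 h2 h3)\<^sup>2 \<le> (13661/10000)\<^sup>2 * edge_dist 0 h1 h2"
    by (rule foot_le[OF _ _ a(1,2) _ h le]) (use sqrt3_bound[OF assms(2)] in simp_all)
  also have "\<dots> \<le> (281/100 - apex 0 a (1/2) / 2) * edge_dist 0 h1 h2"
  proof (rule mult_right_mono)
    show "(13661/10000)\<^sup>2 \<le> 281/100 - apex 0 a (1/2) / 2"
    proof -
      have "apex 0 a (1/2) \<le> 3/4" by (simp add: apex_def power2_eq_square)
      moreover have "(13661/10000::real)\<^sup>2 \<le> 19/10" by (simp add: power2_eq_square)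
      ultimately show ?thesis by linarith
    qed
  qed (simp add: edge_dist_def)
  finally show ?thesis .
qed

text \<open>The cases are which of \<open>a\<close> and \<open>b\<close> vanish; exchanging facets 1
  and 2 picks the better face for the comparison. If neither vanishes, positivity of
  \<open>apex\<close> forces \<open>c = 0\<close> and one of the other two to be 1/2.\<close>

lemma vertex_bound:
  assumes cox: "coxeter_cos c" "coxeter_cos a" "coxeter_cos b" and pos: "apex c a b > 0"
    and h: "0 < h1" "0 < h2" "0 < h3"
    and le: "edge_dist a h1 h3 \<le> edge_dist c h1 h2" "edge_dist b h2 h3 \<le> edge_dist c h1 h2"
  shows "(foot c a b h1 h2 h3)\<^sup>2 \<le> (281/100 - apex c a b / 2) * edge_dist c h1 h2"
proof -
  note c = coxeter_cosD[OF cox(1)] and a = coxeter_cosD[OF cox(2)] and b = coxeter_cosD[OF cox(3)]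
  have c2: "c\<^sup>2 < 1" using c by (simp add: power_less_one_iff)
  have half: "x = 0 \<or> 1/2 \<le> x" if "coxeter_cos x" for x
  proof -
    have "x\<^sup>2 \<le> x" using coxeter_cosD(1,2)[OF that] by (simp add: power2_eq_square mult_left_le)
    thus ?thesis using coxeter_cosD(3)[OF that] by auto
  qed
  have le': "edge_dist b h2 h3 \<le> edge_dist c h2 h1" using le(2) by (simp add: edge_dist_commute)
  consider "a = 0" "b = 0" | "1/2 \<le> a" "b = 0" | "a = 0" "1/2 \<le> b" | "1/2 \<le> a" "1/2 \<le> b"
    using half[OF cox(2)] half[OF cox(3)] by blast
  thus ?thesis
  proof cases
    case 1
    have "(foot c a b h1 h2 h3)\<^sup>2 \<le> 1\<^sup>2 * edge_dist c h1 h2"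
      by (rule foot_le[OF c(1,2) a(1,2) b(1) h le(1)]) (use 1 in simp)
    also have "\<dots> \<le> (281/100 - apex c a b / 2) * edge_dist c h1 h2"
    proof (rule mult_right_mono)
      show "edge_dist c h1 h2 \<ge> 0" unfolding edge_dist_def using c h c2 by (intro divide_nonneg_pos) auto
    qed (use 1 in \<open>simp add: apex_def\<close>)
    finally show ?thesis .
  next
    case 2
    thus ?thesis using vertex_bound_right_angle[OF cox(1,2) 2(1) _ h le(1)] pos by simp
  next
    case 3
    thus ?thesis using vertex_bound_right_angle[OF cox(1,3) 3(2) _ h(2,1,3) le'] pos
      by (simp add: foot_swap[of c 0] apex_swap[of c 0] edge_dist_commute[of c h2])
  next
    case 4
    have lt: "a\<^sup>2 + b\<^sup>2 + 2 * c * a * b < 1 - c\<^sup>2" using pos c2 by (simp add: apex_def)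
    have "c = 0"
    proof (rule ccontr)
      assume "c \<noteq> 0"
      hence "1/2 \<le> c" using half[OF cox(1)] by blast
      hence "(1/2)\<^sup>2 \<le> a\<^sup>2" "(1/2)\<^sup>2 \<le> b\<^sup>2" "(1/2)\<^sup>2 \<le> c\<^sup>2" using 4 by (auto intro!: power_mono)
      moreover have "(1/2) * (1/2) * (1/2) \<le> c * a * b"
        using 4 \<open>1/2 \<le> c\<close> by (intro mult_mono) auto
      ultimately show False using lt by (simp add: power2_eq_square)
    qed
    hence "a = 1/2 \<or> b = 1/2" using lt a(3) b(3) 4 by auto
    thus ?thesis
    proof
      assume b': "b = 1/2"
      show ?thesis using pos le(1) unfolding b' \<open>c = 0\<close>
        by (rule vertex_bound_half[OF cox(2) 4(1) _ h])
    next
      assume a': "a = 1/2"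
      show ?thesis using pos le'
        unfolding a' \<open>c = 0\<close> foot_swap[of 0 "1/2"] apex_swap[of 0 "1/2"] edge_dist_commute[of 0 h1]
        by (rule vertex_bound_half[OF cox(3) 4(2) _ h(2,1,3)])
    qed
  qed
qed

section \<open>Width of a ridge\<close>

text \<open>\<open>res\<close> is the orthogonal projection onto the complement of \<open>e1\<close>
  and \<open>e2\<close>; its coefficients come from inverting their Gram matrix, with off-diagonal
  entries \<open>- c\<close>.\<close>

lemma lor_residual:
  fixes e1 e2 :: "real^4"
  defines "c \<equiv> - lor e1 e2"
  defines "res \<equiv> \<lambda>x. x - ((lor x e1 + c * lor x e2) / (1 - c\<^sup>2)) *\<^sub>R e1
    - ((lor x e2 + c * lor x e1) / (1 - c\<^sup>2)) *\<^sub>R e2"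
  assumes e: "lor e1 e1 = 1" "lor e2 e2 = 1" and c: "c\<^sup>2 < 1"
  shows "lor (res x) e1 = 0" "lor (res x) e2 = 0"
    "lor (res x) (res y) = lor x y - (lor x e1 * lor y e1 + lor x e2 * lor y e2
      + c * (lor x e1 * lor y e2 + lor x e2 * lor y e1)) / (1 - c\<^sup>2)"
proof -
  have s: "1 - c\<^sup>2 \<noteq> 0" using c by simp
  have e12: "lor e1 e2 = - c" "lor e2 e1 = - c" by (simp_all add: c_def lor_commute)
  have *: "lor (res x) e1 = 0 \<and> lor (res x) e2 = 0" for x
  proof -
    define \<alpha> where "\<alpha> = (lor x e1 + c * lor x e2) / (1 - c\<^sup>2)"
    define \<beta> where "\<beta> = (lor x e2 + c * lor x e1) / (1 - c\<^sup>2)"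
    have "\<alpha> * (1 - c\<^sup>2) = lor x e1 + c * lor x e2" "\<beta> * (1 - c\<^sup>2) = lor x e2 + c * lor x e1"
      using s by (simp_all add: \<alpha>_def \<beta>_def)
    hence "(lor x e1 - \<alpha> + c * \<beta>) * (1 - c\<^sup>2) = 0" "(lor x e2 - \<beta> + c * \<alpha>) * (1 - c\<^sup>2) = 0"
      by algebra+
    hence "lor x e1 - \<alpha> + c * \<beta> = 0" "lor x e2 - \<beta> + c * \<alpha> = 0" using s by auto
    moreover have "res x = x - \<alpha> *\<^sub>R e1 - \<beta> *\<^sub>R e2" by (simp add: res_def \<alpha>_def \<beta>_def)
    ultimately show ?thesis by (simp add: e e12 mult.commute)
  qed
  show "lor (res x) e1 = 0" "lor (res x) e2 = 0" using * by auto
  have "lor (res x) (res y) = lor (res x) y"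
    using *[of x] by (subst (2) res_def) (simp add: lor_commute)
  also have "\<dots> = lor x y - ((lor x e1 + c * lor x e2) * lor y e1 + (lor x e2 + c * lor x e1) * lor y e2) / (1 - c\<^sup>2)"
    by (simp add: res_def lor_commute add_divide_distrib distrib_right)
  also have "(lor x e1 + c * lor x e2) * lor y e1 + (lor x e2 + c * lor x e1) * lor y e2
    = lor x e1 * lor y e1 + lor x e2 * lor y e2 + c * (lor x e1 * lor y e2 + lor x e2 * lor y e1)"
    by (simp add: algebra_simps)
  finally show "lor (res x) (res y) = lor x y - (lor x e1 * lor y e1 + lor x e2 * lor y e2
      + c * (lor x e1 * lor y e2 + lor x e2 * lor y e1)) / (1 - c\<^sup>2)" .
qed

text \<open>Projecting to the complement of \<open>e1\<close> and \<open>e2\<close>, the plane over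
  the line of the edge, turns \<open>e3\<close> and \<open>e4\<close> into vectors with squares
  \<open>A\<close> and products \<open>- F\<close> with the timelike projection of \<open>p\<close>.
  The reversed Cauchy-Schwarz inequality for their sum bounds \<open>T\<close>, and the vertex
  estimates control \<open>F\<close>.\<close>

lemma framing_bound:
  fixes p e1 e2 e3 e4 :: "real^4"
  defines "h \<equiv> \<lambda>e. - lor p e" and "c \<equiv> \<lambda>x y. - lor x y"
  assumes unit: "lor e1 e1 = 1" "lor e2 e2 = 1" "lor e3 e3 = 1" "lor e4 e4 = 1"
    and p: "p \<in> H3" and h: "h e1 > 0" "h e2 > 0" "h e3 > 0" "h e4 > 0"
    and cox: "coxeter_cos (c e1 e2)" "coxeter_cos (c e1 e3)" "coxeter_cos (c e2 e3)"
      "coxeter_cos (c e1 e4)" "coxeter_cos (c e2 e4)"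
    and u: "lor u e1 = 0" "lor u e2 = 0" "lor u e3 \<noteq> 0" "lor u e4 \<noteq> 0"
    and V: "V3 \<in> Fut" "lor V3 e1 = 0" "lor V3 e2 = 0" "lor V3 e3 = 0"
           "V4 \<in> Fut" "lor V4 e1 = 0" "lor V4 e2 = 0" "lor V4 e4 = 0"
    and le: "edge_dist (c e1 e3) (h e1) (h e3) \<le> edge_dist (c e1 e2) (h e1) (h e2)"
      "edge_dist (c e2 e3) (h e2) (h e3) \<le> edge_dist (c e1 e2) (h e1) (h e2)"
      "edge_dist (c e1 e4) (h e1) (h e4) \<le> edge_dist (c e1 e2) (h e1) (h e2)"
      "edge_dist (c e2 e4) (h e2) (h e4) \<le> edge_dist (c e1 e2) (h e1) (h e2)"
  shows "- lor e3 e4 \<le> 562/100"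
proof -
  define k where "k = c e1 e2"
  note cs = coxeter_cosD(1,2)[OF cox(1)] coxeter_cosD(1)[OF cox(2)] coxeter_cosD(1)[OF cox(3)]
    coxeter_cosD(1)[OF cox(4)] coxeter_cosD(1)[OF cox(5)]
  have k: "0 \<le> k" "k < 1" using cs by (auto simp: k_def)
  hence k2: "k\<^sup>2 < 1" by (simp add: power_less_one_iff)
  define res where "res x = x - ((lor x e1 + k * lor x e2) / (1 - k\<^sup>2)) *\<^sub>R e1
    - ((lor x e2 + k * lor x e1) / (1 - k\<^sup>2)) *\<^sub>R e2" for x
  have res: "lor (res x) (res y) = lor x y - (lor x e1 * lor y e1 + lor x e2 * lor y e2
      + k * (lor x e1 * lor y e2 + lor x e2 * lor y e1)) / (1 - k\<^sup>2)" for x y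
    using lor_residual(3)[OF unit(1,2), of x y] k2 unfolding res_def k_def c_def by simp
  define D where "D = edge_dist k (h e1) (h e2)"
  define A where "A e = apex k (c e1 e) (c e2 e)" for e
  define F where "F e = foot k (c e1 e) (c e2 e) (h e1) (h e2) (h e)" for e
  have ce: "lor e e1 = - c e1 e" "lor e e2 = - c e2 e" for e by (simp_all add: c_def lor_commute)
  have he: "lor p e = - h e" for e by (simp add: h_def)
  have cp: "c e1 p = h e1" "c e2 p = h e2" by (simp_all add: c_def h_def lor_commute)
  have hp: "h p = 1" using p by (simp add: h_def H3_def)
  have A: "lor (res e) (res e) = A e" if "lor e e = 1" for e
    unfolding res ce A_def apex_def using that by (simp add: power2_eq_square algebra_simps)
  have F: "lor (res e) (res p) = - F e" for e
    unfolding res ce he lor_commute[of e p] F_def foot_def by (simp add: cp algebra_simps)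
  have q: "lor (res p) (res p) = - (1 + D)"
    unfolding res he D_def edge_dist_def by (simp add: hp power2_eq_square algebra_simps)
  have D: "D \<ge> 0" unfolding D_def edge_dist_def using k h k2 by (intro divide_nonneg_pos) auto
  \<comment> \<open>\<open>res e\<close> is nonzero because \<open>u\<close> detects it, and it is
    orthogonal to the vertex \<open>V\<close>, so it is spacelike.\<close>
  have Apos: "A e > 0" if "lor e e = 1" "V \<in> Fut" "lor V e1 = 0" "lor V e2 = 0" "lor V e = 0" "lor u e \<noteq> 0" for e V
  proof -
    have "lor u (res e) \<noteq> 0" using u that by (simp add: res_def)
    hence "res e \<noteq> 0" by auto
    moreover have "lor (res e) V = 0" using that by (simp add: res_def lor_commute)
    ultimately have "lor (res e) (res e) > 0" using lor_orthogonal_timelike FutD(1) that(2) by blast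
    thus ?thesis using A that(1) by simp
  qed
  have A34: "A e3 > 0" "A e4 > 0" using Apos unit V u by blast+
  have A1: "A e3 \<le> 1" "A e4 \<le> 1"
    unfolding A_def apex_def using k k2 cs by (auto intro!: divide_nonneg_pos add_nonneg_nonneg)
  have F3: "(F e3)\<^sup>2 \<le> (281/100 - A e3 / 2) * D"
    using vertex_bound[OF cox(1-3) _ h(1-3) le(1,2)] A34 by (simp add: F_def A_def D_def k_def)
  have F4: "(F e4)\<^sup>2 \<le> (281/100 - A e4 / 2) * D"
    using vertex_bound[OF cox(1,4,5) _ h(1,2,4) le(3,4)] A34 by (simp add: F_def A_def D_def k_def)
  define T where "T = - lor (res e3) (res e4)"
  have "lor (res e3 + res e4) (res e3 + res e4) * lor (res p) (res p) \<le> (lor (res e3 + res e4) (res p))\<^sup>2"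
    using q D by (intro lor_reversed_Cauchy_Schwarz) auto
  hence "(A e3 + A e4 - 2 * T) * (- (1 + D)) \<le> (- F e3 - F e4)\<^sup>2"
    using A[OF unit(3)] A[OF unit(4)] F q by (simp add: T_def lor_commute[of "res e4" "res e3"] algebra_simps)
  also have "(- F e3 - F e4)\<^sup>2 \<le> 2 * (F e3)\<^sup>2 + 2 * (F e4)\<^sup>2"
    using zero_le_power2[of "F e3 - F e4"] by (simp add: power2_eq_square algebra_simps)
  also have "\<dots> \<le> 2 * ((281/100 - A e3 / 2) * D) + 2 * ((281/100 - A e4 / 2) * D)" using F3 F4 by simp
  \<comment> \<open>The sum of the two \<open>A\<close> now appears on both sides; as it is at most
    2, a value of \<open>T\<close> above 5.62 contradicts this for every \<open>D\<close>.\<close>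
  finally have *: "(2 * T - (A e3 + A e4)) * (1 + D) \<le> (1124/100 - (A e3 + A e4)) * D"
    by (simp add: algebra_simps)
  have "T \<le> 562/100"
  proof (rule ccontr)
    assume "\<not> ?thesis"
    hence "(1124/100 - (A e3 + A e4)) * (1 + D) \<le> (2 * T - (A e3 + A e4)) * (1 + D)"
      using D by (intro mult_right_mono) auto
    hence "(1124/100 - (A e3 + A e4)) * (1 + D) \<le> (1124/100 - (A e3 + A e4)) * D" using * by linarith
    hence "1124/100 - (A e3 + A e4) \<le> 0" by (simp add: algebra_simps)
    thus False using A1 by simp
  qed
  \<comment> \<open>Projecting can only increase this quantity, since all cosines with
    \<open>e1\<close> and \<open>e2\<close> are nonnegative.\<close>
  moreover have "- lor e3 e4 \<le> T"
  proof -
    have "(lor e3 e1 * lor e4 e1 + lor e3 e2 * lor e4 e2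
      + k * (lor e3 e1 * lor e4 e2 + lor e3 e2 * lor e4 e1)) / (1 - k\<^sup>2) \<ge> 0"
      unfolding ce using k k2 cs by (intro divide_nonneg_pos) auto
    thus ?thesis unfolding T_def res by simp
  qed
  ultimately show ?thesis by simp
qed

section \<open>Distance between two facets\<close>

context acute_polytope
begin

text \<open>If the planes are ultraparallel, the feet of their common perpendicular are nonnegative
  combinations of \<open>i\<close> and \<open>j\<close>, hence nonpositive on all other normals, and
  so lie in the facets. Planes tangent at infinity would put a lightlike vector into the cone. If
  the planes cross, so do the facets, and the width is 1.\<close>

lemma ridge_width_le:
  assumes i: "i \<in> N" and j: "j \<in> N" and ij: "i \<noteq> j"
  shows "ridge_width P i j \<le> max 1 (- lor i j)"
proof -
  define S where "S = {hdist x y | x y. x \<in> hfacet P i \<and> y \<in> hfacet P j}"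
  define g where "g = lor i j"
  have ji: "lor j i = g" by (simp add: g_def lor_commute)
  have u: "lor i i = 1" "lor j j = 1" using unit i j by auto
  have g0: "g \<le> 0" using lor_nonpos[OF i j ij] by (simp add: g_def)
  have nonneg: "s \<ge> 0" if "s \<in> S" for s
    using that H3_lor_le by (auto simp: S_def hdist_def mem_hfacet)
  have bdd: "bdd_below S" using nonneg by (rule bdd_belowI)
  have le: "ridge_width P i j \<le> r" if r: "r \<ge> 1" and xy: "x \<in> hfacet P i" "y \<in> hfacet P j" "- lor x y = r" for r x y
  proof -
    have "hdist x y \<in> S" using xy by (auto simp: S_def)
    hence "Inf S \<le> arcosh r" using cInf_lower[OF _ bdd] xy(3) by (simp add: hdist_def)
    moreover have "Inf S \<ge> 0" using nonneg \<open>hdist x y \<in> S\<close> by (intro cInf_greatest) auto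
    ultimately have "cosh (Inf S) \<le> cosh (arcosh r)" by (simp add: cosh_real_nonneg_le_iff)
    thus ?thesis using r by (simp add: ridge_width_def S_def)
  qed
  have cone: "a *\<^sub>R i + b *\<^sub>R j + t *\<^sub>R p \<in> pcone N" if "a \<ge> 0" "b \<ge> 0" "t \<ge> 0"
    "lor (a *\<^sub>R i + b *\<^sub>R j + t *\<^sub>R p) i \<le> 0" "lor (a *\<^sub>R i + b *\<^sub>R j + t *\<^sub>R p) j \<le> 0" for a b t
  proof -
    have "lor (a *\<^sub>R i + b *\<^sub>R j + t *\<^sub>R p) l \<le> 0" if "l \<in> N" "l \<noteq> i" "l \<noteq> j" for l
    proof -
      have "lor i l \<le> 0" "lor j l \<le> 0" "lor p l \<le> 0"
        using lor_nonpos i j that p_neg[of l] by (auto simp: less_imp_le)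
      hence "a * lor i l \<le> 0" "b * lor j l \<le> 0" "t * lor p l \<le> 0"
        using \<open>a \<ge> 0\<close> \<open>b \<ge> 0\<close> \<open>t \<ge> 0\<close> by (auto intro: mult_nonneg_nonpos)
      thus ?thesis by simp
    qed
    thus ?thesis using that(4,5) unfolding pcone_def by blast
  qed
  consider "g < -1" | "g = -1" | "g > -1" by linarith
  thus ?thesis
  proof cases
    case 1
    have g2: "g * g > 1" using 1 mult_strict_mono[of 1 "- g" 1 "- g"] by simp
    \<comment> \<open>The part of \<open>j\<close> orthogonal to \<open>i\<close>: up to scaling,
      the foot of the common perpendicular in the plane of \<open>i\<close>.\<close>
    define x where "x = (- g) *\<^sub>R i + 1 *\<^sub>R j + 0 *\<^sub>R p"
    define y where "y = 1 *\<^sub>R i + (- g) *\<^sub>R j + 0 *\<^sub>R p"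
    have xi: "lor x i = 0" "lor x j = 1 - g * g" and yj: "lor y j = 0" "lor y i = 1 - g * g"
      by (simp_all add: x_def y_def u ji g_def[symmetric])
    have xK: "x \<in> pcone N" unfolding x_def by (rule cone) (use xi g0 g2 in \<open>auto simp: x_def\<close>)
    have yK: "y \<in> pcone N" unfolding y_def by (rule cone) (use yj g0 g2 in \<open>auto simp: y_def\<close>)
    have n0: "x \<noteq> 0" "y \<noteq> 0" using xi yj g2 by auto
    have xx: "lor x x = 1 - g * g" by (subst (2) x_def) (simp add: xi)
    have yy: "lor y y = 1 - g * g" by (subst (2) y_def) (simp add: yj)
    have "lor x y = - g * (1 - g * g)" by (subst y_def) (simp add: xi)
    hence "- lor (nz x) (nz y) = - g"
      using g2 by (simp add: xx yy nz_def field_simps)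
    hence "ridge_width P i j \<le> - g"
      using le[of "- g" "nz x" "nz y"] 1 nz_hfacet[OF xK n0(1)] nz_hfacet[OF yK n0(2)] xi yj by simp
    thus ?thesis by (simp add: g_def)
  next
    case 2
    define x where "x = 1 *\<^sub>R i + 1 *\<^sub>R j + 0 *\<^sub>R p"
    have x: "lor x i = 0" "lor x j = 0" by (simp_all add: x_def u ji g_def[symmetric] 2)
    have "x \<in> pcone N" unfolding x_def by (rule cone) (use x in \<open>auto simp: x_def\<close>)
    moreover have "lor p x < 0" using p_neg[OF i] p_neg[OF j] by (simp add: x_def)
    hence "x \<noteq> 0" by auto
    moreover have "lor x x = 0" by (subst (2) x_def) (simp add: x)
    ultimately show ?thesis using not_spacelike[of x] by simp
  next
    case 3
    have g2: "1 - g * g > 0" using 3 g0 mult_strict_mono[of "- g" 1 "- g" 1] by simp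
    define pi' where "pi' = lor p i"
    define pj' where "pj' = lor p j"
    have neg: "pi' < 0" "pj' < 0" using p_neg i j by (auto simp: pi'_def pj'_def)
    \<comment> \<open>Coefficients that project \<open>p\<close> onto the complement of
      \<open>i\<close> and \<open>j\<close>; they are nonnegative because \<open>g\<close>,
      \<open>pi'\<close> and \<open>pj'\<close> are nonpositive.\<close>
    define a where "a = (g * pj' - pi') / (1 - g * g)"
    define b where "b = (g * pi' - pj') / (1 - g * g)"
    have "g * pj' \<ge> 0" "g * pi' \<ge> 0" using g0 neg by (auto intro: mult_nonpos_nonpos)
    hence ab: "a \<ge> 0" "b \<ge> 0" using g2 neg by (auto simp: a_def b_def)
    define x where "x = a *\<^sub>R i + b *\<^sub>R j + 1 *\<^sub>R p"
    have "a * (1 - g * g) = g * pj' - pi'" "b * (1 - g * g) = g * pi' - pj'"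
      using g2 by (simp_all add: a_def b_def)
    hence "(a + b * g + pi') * (1 - g * g) = 0" "(a * g + b + pj') * (1 - g * g) = 0" by algebra+
    hence "a + b * g + pi' = 0" "a * g + b + pj' = 0" using g2 by auto
    hence x: "lor x i = 0" "lor x j = 0"
      by (simp_all add: x_def u ji g_def[symmetric] pi'_def pj'_def algebra_simps)
    have xK: "x \<in> pcone N" unfolding x_def by (rule cone) (use x ab in \<open>auto simp: x_def\<close>)
    have "lor p x = a * pi' + b * pj' - 1" using p_H3 by (simp add: x_def pi'_def pj'_def H3_def)
    also have "\<dots> < 0" using ab neg mult_nonneg_nonpos[of a pi'] mult_nonneg_nonpos[of b pj'] by simp
    finally have x0: "x \<noteq> 0" by auto
    have "nz x \<in> H3" using nz_P[OF xK x0] by blast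
    hence "- lor (nz x) (nz x) = 1" by (simp add: H3_def)
    hence "ridge_width P i j \<le> 1"
      using le[of 1 "nz x" "nz x"] nz_hfacet[OF xK x0] x by simp
    thus ?thesis by simp
  qed
qed

end

section \<open>The edge farthest from the interior point\<close>

locale coxeter_cone = irredundant_polytope +
  assumes coxeter: "adjacent P j k \<Longrightarrow> coxeter_cos (- lor j k)"

sublocale coxeter_cone \<subseteq> acute_polytope
proof unfold_locales
  fix j k assume "adjacent P j k"
  thus "lor j k \<le> 0" using coxeter_cosD(1)[OF coxeter] by simp
qed

context coxeter_cone
begin

text \<open>An edge maximizing \<open>edge_dist\<close> is at least as far from \<open>p\<close> as
  the four edges that meet its ends in the facets of \<open>e1\<close> and \<open>e2\<close>; these
  are the comparisons needed in \<open>framing_bound\<close>.\<close>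

lemma exists_narrow_ridge:
  "\<exists>e1 e2 e3 e4. is_ridge P e1 e2 e3 e4 \<and> ridge_width P e3 e4 \<le> 562/100"
proof -
  define f where "f = (\<lambda>(j,k). edge_dist (- lor j k) (- lor p j) (- lor p k))"
  define G where "G = {(j,k). adjacent P j k}"
  have "G \<subseteq> N \<times> N" using adjacentD by (auto simp: G_def)
  hence finG: "finite G" using fin by (meson finite_SigmaI finite_subset)
  have "N \<noteq> {}"
  proof
    assume "N = {}"
    hence "- p \<in> pcone N" by (simp add: pcone_def)
    moreover have "p \<noteq> 0" using FutD(3)[OF H3_Fut[OF p_H3]] .
    ultimately have "- p \<in> Fut" using pcone_Fut by simp
    thus False using FutD(2)[of "- p"] FutD(2)[OF H3_Fut[OF p_H3]] by simp
  qed
  then obtain j where j: "j \<in> N" by blast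
  have "\<exists>k. adjacent P j k" by (rule wall_cut_out_by_adjacent[OF j]) blast
  hence "G \<noteq> {}" by (auto simp: G_def)
  hence "Max (f ` G) \<in> f ` G" using finG by (intro Max_in) auto
  then obtain e1 e2 where "(e1, e2) \<in> G" "f (e1, e2) = Max (f ` G)" by force
  hence max: "f x \<le> f (e1, e2)" if "x \<in> G" for x
    using that finG by (auto simp: G_def)
  have max': "edge_dist (- lor j k) (- lor p j) (- lor p k) \<le> edge_dist (- lor e1 e2) (- lor p e1) (- lor p e2)"
    if "adjacent P j k" for j k using max[of "(j,k)"] that by (simp add: f_def G_def)
  have adj: "adjacent P e1 e2" using \<open>(e1, e2) \<in> G\<close> by (simp add: G_def)
  note e12 = adjacentD[OF adj]
  obtain w where w: "w \<in> pcone N" "w \<noteq> 0" "lor w e1 = 0" "lor w e2 = 0"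
    "\<And>l. l \<in> N - {e1,e2} \<Longrightarrow> lor w l < 0" using edge_interior[OF adj] by blast
  \<comment> \<open>\<open>u\<close> is the direction of the edge at \<open>w\<close>; following
    \<open>u\<close> and \<open>- u\<close> gives the two ends and the framing facets.\<close>
  obtain u where u: "u \<noteq> 0" "lor u e1 = 0" "lor u e2 = 0" "lor u w = 0"
    using exists_lor_orthogonal by blast
  obtain t e3 where e3: "t > 0" "e3 \<in> N - {e1,e2}" "lor u e3 > 0" "w + t *\<^sub>R u \<in> pcone N"
    "lor (w + t *\<^sub>R u) e3 = 0" using edge_endpoint[OF w(1,2,5) u w(3,4)] by blast
  obtain t' e4 where e4: "t' > 0" "e4 \<in> N - {e1,e2}" "lor (- u) e4 > 0" "w + t' *\<^sub>R (- u) \<in> pcone N"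
    "lor (w + t' *\<^sub>R (- u)) e4 = 0"
  proof (rule edge_endpoint[OF w(1,2,5)])
    show "- u \<noteq> 0" "lor (- u) e1 = 0" "lor (- u) e2 = 0" "lor (- u) w = 0" using u by simp_all
  qed (use w(3,4) in blast)+
  define V where "V = w + t *\<^sub>R u"
  define V' where "V' = w + t' *\<^sub>R (- u)"
  have ww: "lor w w < 0" using FutD(1)[OF pcone_Fut[OF w(1,2)]] .
  have "lor V w < 0" "lor V' w < 0" using ww u(4) by (simp_all add: V_def V'_def)
  hence V0: "V \<noteq> 0" "V' \<noteq> 0" by auto
  have V: "V \<in> pcone N" "lor V e1 = 0" "lor V e2 = 0" "lor V e3 = 0"
    and V': "V' \<in> pcone N" "lor V' e1 = 0" "lor V' e2 = 0" "lor V' e4 = 0"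
    using e3(4,5) e4(4,5) w(3,4) u(2,3) unfolding V_def[symmetric] V'_def[symmetric]
    by (simp_all add: V_def V'_def)
  have e34: "e3 \<noteq> e4" using e3(3) e4(3) by auto
  have neg: "lor w e3 < 0" "lor w e4 < 0" using w(5)[OF e3(2)] w(5)[OF e4(2)] .
  have "t * lor u e4 < 0" using e3(1) e4(3) by (simp add: mult_pos_neg)
  hence Ve4: "lor V e4 < 0" using neg by (simp add: V_def)
  have ridge: "is_ridge P e1 e2 e3 e4"
  proof -
    have "nz w \<in> hfacet P e1 \<inter> hfacet P e2" "nz w \<notin> hfacet P e3" "nz w \<notin> hfacet P e4"
      using nz_hfacet[OF w(1,2)] w neg by auto
    moreover have "nz V \<in> hfacet P e3 \<inter> (hfacet P e1 \<inter> hfacet P e2)" "nz V \<notin> hfacet P e4"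
      using nz_hfacet[OF V(1) V0(1)] V Ve4 by auto
    moreover have "nz V' \<in> hfacet P e4 \<inter> (hfacet P e1 \<inter> hfacet P e2)"
      using nz_hfacet[OF V'(1) V0(2)] V' by auto
    moreover have "facet_normal P e3" "facet_normal P e4" using facet_normal_N e3 e4 by auto
    ultimately show ?thesis unfolding is_ridge_def Let_def using adj by blast
  qed
  have a3: "adjacent P e1 e3" "adjacent P e2 e3"
    using adjacent_at_vertex[of e1 e2 e3 V] adjacent_at_vertex[of e2 e1 e3 V] e12 e3(2) V V0 by auto
  have a4: "adjacent P e1 e4" "adjacent P e2 e4"
    using adjacent_at_vertex[of e1 e2 e4 V'] adjacent_at_vertex[of e2 e1 e4 V'] e12 e4(2) V' V0 by auto
  have "- lor e3 e4 \<le> 562/100"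
  proof (rule framing_bound[where p = p and u = u and ?V3.0 = V and ?V4.0 = V'])
    show "lor e1 e1 = 1" "lor e2 e2 = 1" "lor e3 e3 = 1" "lor e4 e4 = 1"
      using unit e12 e3(2) e4(2) by auto
    show "p \<in> H3" by (rule p_H3)
    show "0 < - lor p e1" "0 < - lor p e2" "0 < - lor p e3" "0 < - lor p e4"
      using p_neg e12 e3(2) e4(2) by auto
    show "coxeter_cos (- lor e1 e2)" "coxeter_cos (- lor e1 e3)" "coxeter_cos (- lor e2 e3)"
      "coxeter_cos (- lor e1 e4)" "coxeter_cos (- lor e2 e4)" using coxeter adj a3 a4 by auto
    show "lor u e1 = 0" "lor u e2 = 0" "lor u e3 \<noteq> 0" "lor u e4 \<noteq> 0" using u e3(3) e4(3) by auto
    show "V \<in> Fut" "V' \<in> Fut" using V(1) V'(1) V0 pcone_Fut by auto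
  qed (use V V' max' a3 a4 in auto)
  moreover have "ridge_width P e3 e4 \<le> max 1 (- lor e3 e4)"
    using ridge_width_le e3(2) e4(2) e34 by auto
  ultimately show ?thesis using ridge by (intro exI[of _ e1] exI[of _ e2] exI[of _ e3] exI[of _ e4]) auto
qed

end

section \<open>From compact Coxeter polytopes to cones\<close>

definition vec4 :: "real \<Rightarrow> real \<Rightarrow> real \<Rightarrow> real \<Rightarrow> real^4" where
  "vec4 a b c d = (\<chi> i. if i = 1 then a else if i = 2 then b else if i = 3 then c else d)"

lemma vec4_nth [simp]:
  "vec4 a b c d $ 1 = a" "vec4 a b c d $ 2 = b" "vec4 a b c d $ 3 = c" "vec4 a b c d $ 4 = d"
  by (simp_all add: vec4_def)

lemma not_bounded_H3: "\<not> bounded H3"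
proof
  assume "bounded H3"
  then obtain B where B: "\<And>x. x \<in> H3 \<Longrightarrow> norm x \<le> B" by (auto simp: bounded_iff)
  define x :: "real^4" where "x = vec4 (sqrt (1 + (\<bar>B\<bar> + 1)\<^sup>2)) (\<bar>B\<bar> + 1) 0 0"
  have c: "x$1 = sqrt (1 + (\<bar>B\<bar> + 1)\<^sup>2)" "x$2 = \<bar>B\<bar> + 1" "x$3 = 0" "x$4 = 0"
    by (simp_all add: x_def)
  have pos: "1 + (\<bar>B\<bar> + 1)\<^sup>2 > 0" by (simp add: add_pos_nonneg)
  have "lor x x = -1" unfolding lor_def c using pos by (simp flip: power2_eq_square)
  hence "x \<in> H3" using pos by (simp add: H3_def c)
  hence "norm x \<le> B" by (rule B)
  moreover have "\<bar>x$2\<bar> \<le> norm x" by (rule component_le_norm_cart)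
  ultimately show False unfolding c by simp
qed

lemma H3_Int_halfsp: "H3 \<inter> (\<Inter>e\<in>N. halfsp e) = H3 \<inter> pcone N"
  by (auto simp: halfsp_def pcone_def)

text \<open>Otherwise a small move from \<open>x\<close> along the outward normal would stay in
  \<open>U\<close> and yet leave the half-space.\<close>

lemma open_subset_halfsp_strict:
  assumes U: "openin (top_of_set H3) U" "x \<in> U" "U \<subseteq> halfsp e" and e: "lor e e = 1"
  shows "lor x e < 0"
proof (rule ccontr)
  assume "\<not> ?thesis"
  moreover have xH: "x \<in> H3" "lor x e \<le> 0" using U by (auto simp: halfsp_def)
  ultimately have x0: "lor x e = 0" by simp
  obtain t where t: "t > 0" "x + t *\<^sub>R e \<in> Fut" "nz (x + t *\<^sub>R e) \<in> U"
    by (rule openin_perturb[OF U(1,2) xH(1)]) (auto intro: nz_in_H3)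
  have "lor (nz (x + t *\<^sub>R e)) e \<le> 0" using t(3) U(3) unfolding halfsp_def by blast
  hence "lor (x + t *\<^sub>R e) e \<le> 0" using lor_nz_sign(1)[OF t(2)] by blast
  thus False using x0 e t(1) by simp
qed

text \<open>Both normals are orthogonal to a common point of \<open>H3\<close>, where the form is
  positive semidefinite. The bound ensures that \<open>cos\<close> undoes the \<open>arccos\<close>
  in \<open>dihedral\<close>.\<close>

lemma adjacent_lor_bound:
  assumes "adjacent P j k" shows "\<bar>lor j k\<bar> \<le> 1"
proof -
  obtain x where x: "x \<in> H3" "lor x j = 0" "lor x k = 0" and u: "lor j j = 1" "lor k k = 1"
    using assms by (auto simp: adjacent_def facet_normal_def hfacet_def hplane_def)
  have *: "lor v v \<ge> 0" if "lor x v = 0" for v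
    using lor_orthogonal_timelike[of x v] x(1) that by (cases "v = 0") (auto simp: H3_def lor_commute)
  have "lor (j + k) (j + k) \<ge> 0" "lor (j - k) (j - k) \<ge> 0"
    using x *[of "j + k"] *[of "j - k"] by (simp_all del: lor_simps add: lor_simps(2,4))
  thus ?thesis using u by (simp add: lor_commute[of k j])
qed

lemma compact_coxeter_polytope_cone:
  assumes "compact_coxeter_polytope Q"
  obtains N p where "coxeter_cone N p" "Q = H3 \<inter> pcone N"
proof -
  have Q: "convex_polytope Q" "compact Q"
    and ang: "\<And>e1 e2. adjacent Q e1 e2 \<Longrightarrow> \<exists>k::nat. k \<ge> 2 \<and> dihedral e1 e2 = pi / real k"
    using assms by (auto simp: compact_coxeter_polytope_def coxeter_polytope_def)
  obtain N0 U where N0: "finite N0" "\<And>e. e \<in> N0 \<Longrightarrow> lor e e = 1" "Q = H3 \<inter> pcone N0"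
    and U: "openin (top_of_set H3) U" "U \<noteq> {}" "U \<subseteq> Q"
    using Q(1) unfolding convex_polytope_def H3_Int_halfsp by blast
  obtain p where p: "p \<in> U" using U by blast
  have pH: "p \<in> H3" using p U N0 by blast
  have p_neg: "lor p e < 0" if "e \<in> N0" for e
  proof (rule open_subset_halfsp_strict[OF U(1) p _ N0(2)[OF that]])
    show "U \<subseteq> halfsp e" using U(3) N0(3) that by (auto simp: halfsp_def pcone_def)
  qed
  have bd: "bounded (H3 \<inter> pcone N0)" using Q(2) N0(3) compact_imp_bounded by blast
  \<comment> \<open>An empty \<open>N0\<close> would make the polytope all of \<open>H3\<close>,
    which is unbounded.\<close>
  hence "N0 \<noteq> {}" using not_bounded_H3 by (auto simp: pcone_def)
  note fut = bounded_pcone_Fut[OF this pH p_neg bd]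
  obtain N where N: "N \<subseteq> N0" "UNIV \<inter> pcone N = UNIV \<inter> pcone N0"
    "\<And>k. k \<in> N \<Longrightarrow> \<exists>z\<in>UNIV. (\<forall>l\<in>N-{k}. lor z l \<le> 0) \<and> lor z k > 0"
    by (rule exists_irredundant[OF N0(1), of UNIV]) blast
  have eq: "Q = H3 \<inter> pcone N" using N(2) N0(3) by simp
  have "coxeter_cone N p"
  proof
    show "finite N" using N(1) N0(1) finite_subset by blast
    show "lor e e = 1" if "e \<in> N" for e using that N(1) N0(2) by blast
    show "p \<in> H3" by (rule pH)
    show "lor p e < 0" if "e \<in> N" for e using that N(1) p_neg by blast
    show "z \<in> Fut" if "z \<in> pcone N" "z \<noteq> 0" for z using fut that N(2) by simp
    show "\<exists>w. lor w k = 0 \<and> (\<forall>e\<in>N-{k}. lor w e < 0)" if k: "k \<in> N" for k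
    proof -
      obtain z where z: "\<forall>l\<in>N-{k}. lor z l \<le> 0" "lor z k > 0" using N(3)[OF k] by blast
      have pn: "\<And>l. l \<in> N \<Longrightarrow> lor p l < 0" using N(1) p_neg by blast
      show ?thesis using crossing_point[OF pn k z refl] by blast
    qed
    show "coxeter_cos (- lor j k)" if "adjacent (H3 \<inter> pcone N) j k" for j k
    proof -
      have adj: "adjacent Q j k" using that eq by simp
      obtain m :: nat where m: "m \<ge> 2" "arccos (- lor j k) = pi / real m"
        using ang[OF adj] by (auto simp: dihedral_def)
      have "- lor j k = cos (arccos (- lor j k))"
        using adjacent_lor_bound[OF adj] by (subst cos_arccos) auto
      thus ?thesis using m unfolding coxeter_cos_def by auto
    qed
  qed
  thus ?thesis using that eq by blast
qed

section \<open>The simplex with a ridge of the extremal type\<close>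

text \<open>The golden ratio, which is twice \<open>cos (pi / 5)\<close>.\<close>

definition phi :: real where "phi = (1 + sqrt 5) / 2"

text \<open>The time coordinate that makes \<open>n1\<close> a unit vector:
  \<open>lor n1 n1 = 1\<close> amounts to \<open>4 * (lam * lam) = phi * phi - 2\<close>.\<close>

definition lam :: real where "lam = sqrt (phi - 1) / 2"

lemma phi: "phi * phi = phi + 1" "3/2 \<le> phi" "phi \<le> 17/10"
proof -
  show "phi * phi = phi + 1" by (simp add: phi_def field_simps)
  have "2 \<le> sqrt 5" by (rule real_le_rsqrt) simp
  thus "3/2 \<le> phi" by (simp add: phi_def)
  have "sqrt 5 \<le> 24/10" by (rule real_le_lsqrt) (auto simp: power2_eq_square)
  thus "phi \<le> 17/10" by (simp add: phi_def)
qed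

lemma lam: "4 * (lam * lam) = phi - 1" "1/3 \<le> lam"
proof -
  show *: "4 * (lam * lam) = phi - 1" using phi(2) by (simp add: lam_def)
  show "1/3 \<le> lam"
  proof (rule power2_le_imp_le)
    show "(1/3)\<^sup>2 \<le> lam\<^sup>2" using * phi(2) by (simp add: power2_eq_square)
  qed (use phi(2) in \<open>simp add: lam_def\<close>)
qed

definition n1 :: "real^4" where "n1 = vec4 lam (- (phi / 2)) (- (1/2)) (- (1/2))"
definition n2 :: "real^4" where "n2 = vec4 0 1 0 0"
definition n3 :: "real^4" where "n3 = vec4 0 0 1 0"
definition n4 :: "real^4" where "n4 = vec4 0 0 0 1"

text \<open>n1 is the branching node of the diagram; n2, n3, n4 are mutually orthogonal, which leaves
  only the time coordinate of n1 to be determined.\<close>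
definition tetra :: "(real^4) set" where "tetra = {n1, n2, n3, n4}"

lemma lor_n:
  "lor x n1 = - (x$1 * lam) - x$2 * phi / 2 - x$3 / 2 - x$4 / 2"
  "lor x n2 = x$2" "lor x n3 = x$3" "lor x n4 = x$4"
  by (simp_all add: lor_def n1_def n2_def n3_def n4_def)

lemma n_nth:
  "n1$1 = lam" "n1$2 = - (phi / 2)" "n1$3 = - (1/2)" "n1$4 = - (1/2)"
  "n2$1 = 0" "n2$2 = 1" "n2$3 = 0" "n2$4 = 0"
  "n3$1 = 0" "n3$2 = 0" "n3$3 = 1" "n3$4 = 0"
  "n4$1 = 0" "n4$2 = 0" "n4$3 = 0" "n4$4 = 1"
  by (simp_all add: n1_def n2_def n3_def n4_def)

lemma lor_n1_n1: "lor n1 n1 = 1"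
  using phi(1) lam(1) by (simp add: lor_n n_nth field_simps)

text \<open>On the cone the spatial coordinates are nonpositive, and \<open>n1\<close> bounds their
  total by the time coordinate. As \<open>phi - 1 < 1\<close>, this yields both containment in
  \<open>Fut\<close> and compactness.\<close>

lemma pcone_tetra_spat:
  assumes "z \<in> pcone tetra"
  shows "0 \<le> z$1" "spat z z \<le> (phi - 1) * (z$1 * z$1)"
proof -
  define a b c where "a = - z$2" and "b = - z$3" and "c = - z$4"
  have nn: "a \<ge> 0" "b \<ge> 0" "c \<ge> 0" and le: "phi * a + b + c \<le> 2 * lam * z$1"
    using assms by (auto simp: pcone_def tetra_def lor_n a_def b_def c_def algebra_simps)
  have s: "a + b + c \<le> phi * a + b + c" using mult_right_mono[of 1 phi a] phi(2) nn by simp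
  hence "0 \<le> lam * z$1" using nn le by linarith
  thus "0 \<le> z$1" using lam(2) by (simp add: zero_le_mult_iff)
  have "spat z z = a * a + b * b + c * c" by (simp add: spat_def a_def b_def c_def)
  also have "\<dots> \<le> (a + b + c) * (a + b + c)" using nn by (simp add: algebra_simps)
  also have "\<dots> \<le> (2 * lam * z$1) * (2 * lam * z$1)" using nn s le by (intro mult_mono) auto
  also have "\<dots> = (4 * (lam * lam)) * (z$1 * z$1)" by simp
  finally show "spat z z \<le> (phi - 1) * (z$1 * z$1)" unfolding lam(1) .
qed

lemma pcone_tetra_Fut:
  assumes "z \<in> pcone tetra" "z \<noteq> 0" shows "z \<in> Fut"
proof -
  note z = pcone_tetra_spat[OF assms(1)]
  have "z$1 \<noteq> 0"
  proof
    assume z1: "z$1 = 0"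
    hence "spat z z = 0" using z(2) spat_nonneg[of z] by simp
    thus False using z1 assms(2) by (simp add: spat_self_eq_0_iff vec4_eq_0_iff)
  qed
  hence z1: "z$1 > 0" using z(1) by simp
  hence "(phi - 1) * (z$1 * z$1) < 1 * (z$1 * z$1)" using phi(3) by (intro mult_strict_right_mono) auto
  with z(2) have "spat z z < 1 * (z$1 * z$1)" by (rule le_less_trans)
  thus ?thesis using z1 by (simp add: Fut_def lor_spat)
qed

definition tetra_center :: "real^4" where "tetra_center = nz (vec4 1 (-1/10) (-1/10) (-1/10))"

interpretation tetra: irredundant_polytope tetra tetra_center
proof
  show "finite tetra" by (simp add: tetra_def)
  show "lor e e = 1" if "e \<in> tetra" for e
    using that lor_n1_n1 by (auto simp: tetra_def lor_n n_nth)
  have F: "vec4 1 (-1/10) (-1/10) (-1/10) \<in> Fut" by (simp add: Fut_def lor_def)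
  show "tetra_center \<in> H3" unfolding tetra_center_def using F by (rule nz_in_H3)
  show "lor tetra_center e < 0" if "e \<in> tetra" for e
    unfolding tetra_center_def lor_nz_sign(3)[OF F]
    using that lam(2) phi by (auto simp: tetra_def lor_n)
  show "z \<in> Fut" if "z \<in> pcone tetra" "z \<noteq> 0" for z using that by (rule pcone_tetra_Fut)
  show "\<exists>w. lor w f = 0 \<and> (\<forall>e\<in>tetra-{f}. lor w e < 0)" if "f \<in> tetra" for f
  proof -
    \<comment> \<open>Chosen so that the point with all spatial coordinates
      \<open>- \<delta>\<close> lies on the wall of \<open>n1\<close>.\<close>
    define \<delta> where "\<delta> = 2 * lam / (phi + 2)"
    have d: "\<delta> > 0" "\<delta> * (phi + 2) = 2 * lam" using lam(2) phi(2) by (auto simp: \<delta>_def)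
    have "lor (vec4 1 (-\<delta>) (-\<delta>) (-\<delta>)) n1 = 0" using d(2) by (simp add: lor_n algebra_simps)
    hence 1: ?thesis if "f = n1"
      using that d(1) by (intro exI[of _ "vec4 1 (-\<delta>) (-\<delta>) (-\<delta>)"]) (auto simp: tetra_def lor_n)
    have 2: ?thesis if "f = n2"
      using that lam(2) by (intro exI[of _ "vec4 1 0 (-1/10) (-1/10)"]) (auto simp: tetra_def lor_n)
    have 3: ?thesis if "f = n3"
      using that lam(2) phi(3) by (intro exI[of _ "vec4 1 (-1/10) 0 (-1/10)"]) (auto simp: tetra_def lor_n)
    have 4: ?thesis if "f = n4"
      using that lam(2) phi(3) by (intro exI[of _ "vec4 1 (-1/10) (-1/10) 0"]) (auto simp: tetra_def lor_n)
    from 1 2 3 4 show ?thesis using that by (auto simp: tetra_def)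
  qed
qed

lemma dihedral_n:
  "dihedral n1 n2 = pi / 5" "dihedral n1 n3 = pi / 3" "dihedral n1 n4 = pi / 3"
  "dihedral n2 n3 = pi / 2" "dihedral n2 n4 = pi / 2" "dihedral n3 n4 = pi / 2"
proof -
  have "arccos (cos (pi/5)) = pi / 5" "arccos (cos (pi/3)) = pi / 3" by (simp_all add: arccos_cos)
  thus "dihedral n1 n2 = pi / 5" "dihedral n1 n3 = pi / 3" "dihedral n1 n4 = pi / 3"
    by (simp_all add: dihedral_def lor_n n_nth cos_pi_fifth cos_60 phi_def)
  show "dihedral n2 n3 = pi / 2" "dihedral n2 n4 = pi / 2" "dihedral n3 n4 = pi / 2"
    by (simp_all add: dihedral_def lor_n n_nth)
qed

lemma dihedral_commute: "dihedral x y = dihedral y x"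
  by (simp add: dihedral_def lor_commute)

lemma closed_H3: "closed H3"
proof -
  \<comment> \<open>A vector of square -1 cannot have time coordinate 0, so the strict sign
    condition may be relaxed to a closed one.\<close>
  have eq: "H3 = {x. lor x x = -1} \<inter> {x. 0 \<le> x$1}"
  proof (intro set_eqI iffI)
    fix x assume x: "x \<in> {x. lor x x = -1} \<inter> {x. 0 \<le> x$1}"
    hence "x$1 \<noteq> 0" using spat_nonneg[of x] by (auto simp: lor_spat)
    thus "x \<in> H3" using x by (auto simp: H3_def)
  qed (auto simp: H3_def)
  show ?thesis unfolding eq
    by (intro closed_Int closed_Collect_eq closed_Collect_le continuous_on_lor continuous_on_id
        continuous_on_const continuous_on_component)
qed

lemma closed_pcone: "closed (pcone N)"
proof -
  have "pcone N = (\<Inter>e\<in>N. {z. lor z e \<le> 0})" by (auto simp: pcone_def)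
  moreover have "closed {z. lor z e \<le> 0}" for e
    by (intro closed_Collect_le continuous_on_lor continuous_on_id continuous_on_const)
  ultimately show ?thesis by auto
qed

lemma compact_tetra: "compact tetra.P"
proof (rule compact_eq_bounded_closed[THEN iffD2], rule conjI)
  show "closed tetra.P" by (intro closed_Int closed_H3 closed_pcone)
  show "bounded tetra.P"
    unfolding bounded_iff
  proof (intro exI[of _ 3] ballI)
    fix x assume x: "x \<in> tetra.P"
    have "spat x x \<le> (phi - 1) * (x$1 * x$1)" using pcone_tetra_spat(2) x by blast
    also have "\<dots> \<le> 7/10 * (x$1 * x$1)" using phi(3) by (intro mult_right_mono) auto
    finally have "spat x x \<le> 7/10 * (x$1 * x$1)" .
    moreover have "spat x x = x$1 * x$1 - 1" using x by (auto simp: H3_def lor_spat)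
    moreover have "x \<bullet> x = x$1 * x$1 + spat x x" by (simp add: inner_vec_def sum_4 spat_def)
    \<comment> \<open>The squared time coordinate is at most 10/3, so the Euclidean square is at
      most 17/3.\<close>
    ultimately have "x \<bullet> x \<le> 3\<^sup>2" by simp
    thus "norm x \<le> 3" unfolding norm_eq_sqrt_inner by (intro real_le_lsqrt) auto
  qed
qed

lemma compact_coxeter_tetra: "compact_coxeter_polytope tetra.P"
proof -
  have "openin (top_of_set H3) (H3 \<inter> (\<Inter>e\<in>tetra. {x. lor x e < 0}))"
    by (intro openin_open_Int open_INT ballI open_Collect_less continuous_on_lor continuous_on_id
        continuous_on_const tetra.fin)
  moreover have "tetra_center \<in> H3 \<inter> (\<Inter>e\<in>tetra. {x. lor x e < 0})"
    using tetra.p_H3 tetra.p_neg by blast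
  moreover have "H3 \<inter> (\<Inter>e\<in>tetra. {x. lor x e < 0}) \<subseteq> tetra.P"
    by (auto simp: pcone_def less_imp_le)
  ultimately have "convex_polytope tetra.P"
    unfolding convex_polytope_def H3_Int_halfsp using tetra.fin tetra.unit by blast
  moreover have "\<exists>k::nat. k \<ge> 2 \<and> dihedral e f = pi / real k" if "adjacent tetra.P e f" for e f
  proof -
    have "dihedral e f \<in> {pi / real 5, pi / real 3, pi / real 2}"
      using tetra.adjacentD[OF that] dihedral_n dihedral_n[unfolded dihedral_commute[of _ n2]]
        dihedral_n[unfolded dihedral_commute[of _ n3]] dihedral_n[unfolded dihedral_commute[of _ n4]]
      by (auto simp: tetra_def)
    thus ?thesis by (auto intro: exI[of _ "5::nat"] exI[of _ "3::nat"] exI[of _ "2::nat"])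
  qed
  ultimately show ?thesis
    unfolding compact_coxeter_polytope_def coxeter_polytope_def using compact_tetra by blast
qed

lemma tetra_ridge: "is_ridge tetra.P n1 n2 n3 n4"
proof -
  \<comment> \<open>The two ends of the edge, up to scaling: \<open>v\<close> lies on
    \<open>n1\<close>, \<open>n2\<close>, \<open>n3\<close> and \<open>w\<close> on
    \<open>n1\<close>, \<open>n2\<close>, \<open>n4\<close>.\<close>
  define v where "v = vec4 1 0 0 (- 2 * lam)"
  define w where "w = vec4 1 0 (- 2 * lam) 0"
  have v: "v \<in> pcone tetra" "lor v n1 = 0" "lor v n2 = 0" "lor v n3 = 0" "lor v n4 \<noteq> 0" "v \<noteq> 0"
    using lam(2) by (auto simp: pcone_def tetra_def lor_n v_def vec4_eq_0_iff)
  have w: "w \<in> pcone tetra" "lor w n1 = 0" "lor w n2 = 0" "lor w n3 \<noteq> 0" "lor w n4 = 0" "w \<noteq> 0"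
    using lam(2) by (auto simp: pcone_def tetra_def lor_n w_def vec4_eq_0_iff)
  have ne: "n1 \<noteq> n2" using lor_n(3)[of n1] lor_n(3)[of n2] n_nth by auto
  have mem: "n1 \<in> tetra" "n2 \<in> tetra" "n3 \<in> tetra" "n4 \<in> tetra" by (auto simp: tetra_def)
  have "adjacent tetra.P n1 n2"
    by (rule tetra.adjacent_NI[of n1 n2 v w n3]) (use mem ne v w in blast)+
  moreover have "nz v \<in> hfacet tetra.P n3 \<inter> (hfacet tetra.P n1 \<inter> hfacet tetra.P n2)" "nz v \<notin> hfacet tetra.P n4"
    using tetra.nz_hfacet[OF v(1,6)] v by auto
  moreover have "nz w \<in> hfacet tetra.P n4 \<inter> (hfacet tetra.P n1 \<inter> hfacet tetra.P n2)" "nz w \<notin> hfacet tetra.P n3"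
    using tetra.nz_hfacet[OF w(1,6)] w by auto
  moreover have "facet_normal tetra.P n3" "facet_normal tetra.P n4"
    using tetra.facet_normal_N mem by auto
  ultimately show ?thesis unfolding is_ridge_def Let_def by blast
qed

theorem theoremA:
  shows "\<exists>t :: ridge_type \<Rightarrow> real.
     (\<forall>P. compact_coxeter_polytope P \<longrightarrow>
        (\<exists>e1 e2 e3 e4. is_ridge P e1 e2 e3 e4 \<and>
           ridge_width P e3 e4 < t (ridge_type_of e1 e2 e3 e4))) \<and>
     (pi/5, pi/3, pi/3, pi/2, pi/2) \<in> Omega \<and>
     (\<forall>a\<in>Omega. t a \<le> t (pi/5, pi/3, pi/3, pi/2, pi/2)) \<and>
     t (pi/5, pi/3, pi/3, pi/2, pi/2) < 5.75"
proof (intro exI[of _ "\<lambda>_. 57/10"] conjI allI impI ballI)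
  fix Q assume "compact_coxeter_polytope Q"
  then obtain N p where N: "coxeter_cone N p" "Q = H3 \<inter> pcone N"
    by (rule compact_coxeter_polytope_cone)
  interpret coxeter_cone N p by (rule N(1))
  show "\<exists>e1 e2 e3 e4. is_ridge Q e1 e2 e3 e4 \<and> ridge_width Q e3 e4 < 57/10"
    using exists_narrow_ridge unfolding N(2) by force
next
  \<comment> \<open>For a constant function the claim about the maximum comes down to the occurrence
    of this type, which the simplex provides.\<close>
  have "ridge_type_of n1 n2 n3 n4 = (pi/5, pi/3, pi/3, pi/2, pi/2)"
    by (simp add: ridge_type_of_def dihedral_n)
  thus "(pi/5, pi/3, pi/3, pi/2, pi/2) \<in> Omega"
    unfolding Omega_def using compact_coxeter_tetra tetra_ridge by (metis (mono_tags, lifting) mem_Collect_eq)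
qed auto

end
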